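(* Let $n\geq 2$. There exists a set $A\subset\mathbb{R}^n$ such that: (1) $A$ has Lebesgue measure zero; (2) for every $y\in\mathbb{R}^n$ there exist a point $p_y\in\mathbb{R}^n$ and an $(n-1)$-dimensional linear subspace $V_y\subset\mathbb{R}^n$ (a hyperplane containing $0$) such that $y\in p_y+\mathbb{S}^{n-1}$ and $p_y+(\mathbb{S}^{n-1}\setminus V_y)\subset A$. Moreover, the mappings $y\mapsto p_y$ and $y\mapsto V_y$ can be chosen to be Borel.
   Context: $\mathbb{S}^{n-1}$ denotes the unit sphere in $\mathbb{R}^n$. The map $y\mapsto V_y$ takes values in the Grassmannian of $(n-1)$-dimensional linear subspaces of $\mathbb{R}^n$ (with its usual topology). *)

theory Defs
  imports "HOL-Analysis.Analysis"
begin

definition lin_hyperplane :: "(real^'n) set \<Rightarrow> bool" where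
  "lin_hyperplane V \<longleftrightarrow> subspace V \<and> dim V = CARD('n) - 1"

text \<open>The standard embedding of the Grassmannian into matrices: a subspace V is sent
  to the matrix of the orthogonal projection onto V (closest point map).  The usual
  topology on the Grassmannian is the one induced by this embedding, so Borel
  measurability of a Grassmannian-valued map means Borel measurability of its
  composition with this embedding.\<close>
definition proj_matrix :: "(real^'n) set \<Rightarrow> real^'n^'n" where
  "proj_matrix V = (\<chi> i j. closest_point V (axis j 1) $ i)"

end

(* A sphere moving by a small distance in the direction w sweeps out little volume with its cap
   of points at which w is almost tangent. Starting from one segment of centres, replace each
   segment repeatedly by a fine zigzag in two other directions of a fixed plane. The new path stays
   so close to the old one that what was swept cheaply remains cheap, and the splitting is arranged
   so that along every branch all directions of the plane occur, apart from an arc of length epsilon.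
   Hence all of the sphere except a thin neighbourhood of a great subsphere, depending on the branch,
   is swept inside a set of measure at most epsilon. Iterating with epsilon -> 0 gives nested tubes
   around segments. If the unit sphere around y separates the end points of a segment, it separates
   those of some piece of the zigzag, so it selects a branch whose tubes shrink to a centre p with
   |p - y| = 1. A point p + e that leaves the limit superior of the small sets is orthogonal to every
   cluster point of the normals dir phi along the branch, so V can be taken to be the orthogonal
   complement of one of them; the limes superior of the angles selects it in a Borel way. *)

theory Submission
  imports Defs
begin

section \<open>Surface swept by a cap moving tangentially\<close>

text \<open>Cheapness is quadratic: where a moving unit sphere is tangent to its motion up to
  \<open>\<alpha>\<close>, it stays in a cylinder shell of relative thickness of order
  \<open>\<alpha>\<^sup>2\<close>, so a cap costs about \<open>\<alpha>\<^sup>2\<close> per unit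
  length. Turning by \<open>\<alpha>\<close> at each level, a half circle takes about
  \<open>pi / \<alpha>\<close> levels, hence the total is of order \<alpha> times the length of the
  path. That length is the obstacle: a zigzag is longer than the segment it replaces, and ever more
  so as its two directions become nearly opposite, which happens when the arc of directions still to
  be visited closes. The growth factors telescope to a product bounded by \<open>1 / (sin
  (\<epsilon> / 2) * sin ((\<epsilon> - \<alpha>) / 2))\<close>. This is bounded for fixed
  \<epsilon> as \<alpha> tends to 0, but not for \<epsilon> tending to 0; so an arc of length
  \<epsilon> is left out at each stage, and these arcs are the source of the exceptional subspace.
  One plane of directions suffices in every dimension because over a half turn of it each point of
  the sphere meets a tangent direction.\<close>

definition cap :: "'a::euclidean_space \<Rightarrow> real \<Rightarrow> 'a set" where
  "cap w \<alpha> = {e. norm e = 1 \<and> \<bar>e \<bullet> w\<bar> \<le> \<alpha>}"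

definition swept :: "'a::euclidean_space \<Rightarrow> 'a \<Rightarrow> real \<Rightarrow> 'a set \<Rightarrow> 'a set" where
  "swept a w l F = (\<lambda>(t, e). a + t *\<^sub>R w + e) ` ({0..l} \<times> F)"

lemma swept_iff: "z \<in> swept a w l F \<longleftrightarrow> (\<exists>t e. 0 \<le> t \<and> t \<le> l \<and> e \<in> F \<and> z = a + t *\<^sub>R w + e)"
  unfolding swept_def by force

lemma compact_swept: "compact F \<Longrightarrow> compact (swept a w l F)"
  unfolding swept_def
  by (intro compact_continuous_image compact_Times) (auto simp: case_prod_unfold intro!: continuous_intros)

lemma swept_translation: "swept a w l F = (+) a ` swept 0 w l F"
  unfolding swept_def by (auto simp: image_image case_prod_unfold add.assoc)

lemma compact_cap: "compact (cap w \<alpha>)"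
proof -
  have "cap w \<alpha> = sphere 0 1 \<inter> {e. \<bar>e \<bullet> w\<bar> \<le> \<alpha>}"
    by (auto simp: cap_def)
  moreover have "closed {e. \<bar>e \<bullet> w\<bar> \<le> \<alpha>}"
    by (intro closed_Collect_le continuous_intros)
  ultimately show ?thesis
    by (simp add: compact_Int_closed)
qed

lemma compact_half_cap: "compact {e \<in> cap w \<alpha>. 0 \<le> e \<bullet> w}"
proof -
  have "{e \<in> cap w \<alpha>. 0 \<le> e \<bullet> w} = cap w \<alpha> \<inter> {e. 0 \<le> e \<bullet> w}"
    by auto
  moreover have "closed {e. 0 \<le> e \<bullet> w}"
    by (intro closed_Collect_le continuous_intros)
  ultimately show ?thesis
    by (simp add: compact_Int_closed compact_cap)
qed

lemma norm_reject_sqr: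
  fixes w z :: "'a::euclidean_space"
  assumes "norm w = 1"
  shows "(norm (z - (z \<bullet> w) *\<^sub>R w))\<^sup>2 = (norm z)\<^sup>2 - (z \<bullet> w)\<^sup>2"
proof -
  have "w \<bullet> w = 1"
    using assms by (simp add: norm_eq_1)
  then show ?thesis
    unfolding power2_norm_eq_inner by (simp add: inner_diff inner_commute power2_eq_square algebra_simps)
qed

text \<open>The shell is cut out by a dilation, so its volume follows from scaling alone, and
  Bernoulli's inequality makes it linear in \<open>\<alpha>\<^sup>2\<close>. The height 6 leaves
  room for the translates placed in it later; 7 is height plus radius.\<close>

lemma cylinder_shell_measure:
  fixes w :: "'a::euclidean_space" and \<alpha> :: real
  assumes w: "norm w = 1" and \<alpha>: "0 < \<alpha>" "\<alpha> < 1"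
  defines "D \<equiv> {z. \<bar>z \<bullet> w\<bar> \<le> 6 \<and> norm (z - (z \<bullet> w) *\<^sub>R w) \<le> 1}"
  shows "D - (\<lambda>x. (1 - \<alpha>\<^sup>2) *\<^sub>R x) ` D \<in> lmeasurable"
    and "measure lebesgue (D - (\<lambda>x. (1 - \<alpha>\<^sup>2) *\<^sub>R x) ` D)
           \<le> DIM('a) * \<alpha>\<^sup>2 * measure lebesgue (cball (0::'a) 7)"
proof -
  define \<rho> where "\<rho> = 1 - \<alpha>\<^sup>2"
  have \<rho>: "0 < \<rho>" "\<rho> < 1"
    using \<alpha> by (auto simp: \<rho>_def power_less_one_iff)
  have sub: "D \<subseteq> cball 0 7"
  proof
    fix z assume z: "z \<in> D"
    have "norm z \<le> norm ((z \<bullet> w) *\<^sub>R w) + norm (z - (z \<bullet> w) *\<^sub>R w)"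
      by (metis add.commute diff_add_cancel norm_triangle_ineq)
    then show "z \<in> cball 0 7"
      using z w by (auto simp: D_def)
  qed
  have "closed D"
    unfolding D_def by (intro closed_Collect_conj closed_Collect_le continuous_intros)
  then have cD: "compact D"
    using sub bounded_cball bounded_subset compact_eq_bounded_closed by blast
  have cR: "compact ((\<lambda>x. \<rho> *\<^sub>R x) ` D)"
    using cD by (rule compact_scaling)
  have mD: "D \<in> lmeasurable" and mR: "(\<lambda>x. \<rho> *\<^sub>R x) ` D \<in> lmeasurable"
    using cD cR by (auto intro: lmeasurable_compact)
  then show "D - (\<lambda>x. (1 - \<alpha>\<^sup>2) *\<^sub>R x) ` D \<in> lmeasurable"
    unfolding \<rho>_def by (rule fmeasurable_Diff[OF _ fmeasurableD])
  have RD: "(\<lambda>x. \<rho> *\<^sub>R x) ` D \<subseteq> D"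
  proof clarify
    fix z assume z: "z \<in> D"
    have "\<rho> *\<^sub>R z - ((\<rho> *\<^sub>R z) \<bullet> w) *\<^sub>R w = \<rho> *\<^sub>R (z - (z \<bullet> w) *\<^sub>R w)"
      by (simp add: algebra_simps)
    then have "norm (\<rho> *\<^sub>R z - ((\<rho> *\<^sub>R z) \<bullet> w) *\<^sub>R w) = \<rho> * norm (z - (z \<bullet> w) *\<^sub>R w)"
      using \<rho> by simp
    also have "\<dots> \<le> 1 * 1"
      using z \<rho> by (intro mult_mono) (auto simp: D_def)
    finally have "norm (\<rho> *\<^sub>R z - ((\<rho> *\<^sub>R z) \<bullet> w) *\<^sub>R w) \<le> 1" by simp
    moreover have "\<bar>\<rho> *\<^sub>R z \<bullet> w\<bar> \<le> 1 * 6"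
      using z \<rho> unfolding inner_scaleR_left abs_mult by (intro mult_mono) (auto simp: D_def)
    ultimately show "\<rho> *\<^sub>R z \<in> D"
      by (simp add: D_def)
  qed
  have "measure lebesgue (D - (\<lambda>x. \<rho> *\<^sub>R x) ` D) = measure lebesgue D - measure lebesgue ((\<lambda>x. \<rho> *\<^sub>R x) ` D)"
    using mD mR RD by (rule measurable_measure_Diff[OF _ fmeasurableD])
  also have "measure lebesgue ((\<lambda>x. \<rho> *\<^sub>R x) ` D) = \<rho> ^ DIM('a) * measure lebesgue D"
    using measure_lebesgue_affine[of \<rho> 0 D] \<rho> by simp
  also have "measure lebesgue D - \<rho> ^ DIM('a) * measure lebesgue D = (1 - \<rho> ^ DIM('a)) * measure lebesgue D"
    by (simp add: algebra_simps)
  also have "\<dots> \<le> (DIM('a) * \<alpha>\<^sup>2) * measure lebesgue (cball (0::'a) 7)"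
  proof (rule mult_mono)
    show "1 - \<rho> ^ DIM('a) \<le> DIM('a) * \<alpha>\<^sup>2"
      using Bernoulli_inequality[of "-\<alpha>\<^sup>2" "DIM('a)"] \<rho> by (simp add: \<rho>_def)
    show "measure lebesgue D \<le> measure lebesgue (cball (0::'a) 7)"
      using sub mD by (intro measure_mono_fmeasurable) auto
  qed auto
  finally show "measure lebesgue (D - (\<lambda>x. (1 - \<alpha>\<^sup>2) *\<^sub>R x) ` D)
           \<le> DIM('a) * \<alpha>\<^sup>2 * measure lebesgue (cball (0::'a) 7)"
    by (simp add: \<rho>_def)
qed

text \<open>A line in direction \<open>w\<close> meets the sphere in points with opposite inner
  products with \<open>w\<close>; if both are nonnegative, both vanish and the points
  coincide.\<close>

lemma swept_half_cap_disjoint: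
  fixes w :: "'a::euclidean_space"
  assumes w: "norm w = 1" and e: "norm e = 1" "0 \<le> e \<bullet> w" and e': "norm e' = 1" "0 \<le> e' \<bullet> w"
    and eq: "t *\<^sub>R w + e = t' *\<^sub>R w + e'"
  shows "t = t'"
proof -
  define k where "k = t - t'"
  have e'_eq: "e' = e + k *\<^sub>R w"
    using eq by (simp add: k_def algebra_simps)
  have ww: "w \<bullet> w = 1" and ee: "e \<bullet> e = 1" and ee': "e' \<bullet> e' = 1"
    using w e e' by (auto simp: norm_eq_1)
  have "e' \<bullet> e' = 1 + k * (2 * (e \<bullet> w) + k)"
    unfolding e'_eq by (simp add: inner_add ww ee inner_commute algebra_simps)
  then have "k = 0 \<or> k = - 2 * (e \<bullet> w)"
    using ee' by auto
  moreover have "e' \<bullet> w = e \<bullet> w + k"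
    unfolding e'_eq by (simp add: inner_add ww)
  ultimately have "k = 0"
    using e e' by auto
  then show ?thesis by (simp add: k_def)
qed

text \<open>A line in direction \<open>w\<close> meets the half cap at most once, so the translates of the swept set by
  multiples of \<open>2 * l\<close> are disjoint. About \<open>1 / l\<close> of them fit into one thin cylinder shell.\<close>

lemma swept_half_cap_measure:
  fixes w :: "'a::euclidean_space" and \<alpha> :: real
  assumes w: "norm w = 1" and \<alpha>: "0 < \<alpha>" "\<alpha> < 1" and l: "0 < l" "l \<le> 1"
  shows "measure lebesgue (swept a w l {e \<in> cap w \<alpha>. 0 \<le> e \<bullet> w})
           \<le> DIM('a) * measure lebesgue (cball (0::'a) 7) * \<alpha>\<^sup>2 * l"
proof -
  define F where "F = {e \<in> cap w \<alpha>. 0 \<le> e \<bullet> w}"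
  define K where "K = swept 0 w l F"
  define D where "D = {z. \<bar>z \<bullet> w\<bar> \<le> 6 \<and> norm (z - (z \<bullet> w) *\<^sub>R w) \<le> 1}"
  define T where "T = D - (\<lambda>x. (1 - \<alpha>\<^sup>2) *\<^sub>R x) ` D"
  define B where "B = DIM('a) * \<alpha>\<^sup>2 * measure lebesgue (cball (0::'a) 7)"
  have T: "T \<in> lmeasurable" "measure lebesgue T \<le> B"
    using cylinder_shell_measure[OF w \<alpha>] by (auto simp: T_def D_def B_def)
  have ww: "w \<bullet> w = 1"
    using w by (simp add: norm_eq_1)
  \<comment> \<open>With \<open>J * l\<close> between 1 and 2 there are enough copies to gain the
    factor \<open>l\<close>, yet positions \<open>t\<close> stay at most 4, within the height of
    \<open>D\<close>.\<close>
  define J where "J = nat \<lceil>1 / l\<rceil>"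
  have J: "1 \<le> J * l" "J * l \<le> 2"
  proof -
    have *: "1 / l \<le> J" "J \<le> 1 / l + 1"
      using l by (auto simp: J_def)
    show "1 \<le> J * l"
      using *(1) l by (simp add: field_simps)
    have "J * l \<le> (1 / l + 1) * l"
      using *(2) l by (intro mult_right_mono) auto
    also have "\<dots> = 1 + l" using l by (simp add: field_simps)
    finally show "J * l \<le> 2" using l by simp
  qed
  define P where "P j = (+) ((2 * real j * l) *\<^sub>R w) ` K" for j :: nat
  have cK: "compact K"
    unfolding K_def F_def by (intro compact_swept compact_half_cap)
  have mK: "K \<in> lmeasurable"
    using cK by (rule lmeasurable_compact)
  have P: "P j \<in> lmeasurable" "measure lebesgue (P j) = measure lebesgue K" for j
    unfolding P_def using cK by (auto intro!: lmeasurable_compact compact_translation simp: measure_translation)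
  have P_iff: "\<exists>t e. z = t *\<^sub>R w + e \<and> 2 * real j * l \<le> t \<and> t \<le> 2 * real j * l + l \<and> e \<in> F" if "z \<in> P j" for z j
  proof -
    from that obtain t e where "0 \<le> t" "t \<le> l" "e \<in> F" "z = (2 * real j * l) *\<^sub>R w + (t *\<^sub>R w + e)"
      by (auto simp: P_def K_def swept_iff)
    then show ?thesis
      by (intro exI[of _ "2 * real j * l + t"] exI[of _ e]) (auto simp: algebra_simps)
  qed
  have disj: "P i \<inter> P j = {}" if "i < j" for i j
  proof (rule ccontr)
    assume "P i \<inter> P j \<noteq> {}"
    then obtain z where z: "z \<in> P i" "z \<in> P j" by auto
    obtain t e where *: "z = t *\<^sub>R w + e" "t \<le> 2 * real i * l + l" "e \<in> F"
      using P_iff[OF z(1)] by blast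
    obtain t' e' where st': "z = t' *\<^sub>R w + e'" "2 * real j * l \<le> t'" "e' \<in> F"
      using P_iff[OF z(2)] by blast
    have "t *\<^sub>R w + e = t' *\<^sub>R w + e'"
      using *(1) st'(1) by simp
    then have "t = t'"
      by (rule swept_half_cap_disjoint[OF w, rotated -1]) (use *(3) st'(3) in \<open>auto simp: F_def cap_def\<close>)
    then have "2 * real j * l \<le> 2 * real i * l + l"
      using *(2) st'(2) by linarith
    moreover have "(2 * real i + 2) * l \<le> (2 * real j) * l"
      using that l by (intro mult_right_mono) auto
    ultimately show False using l by (simp add: algebra_simps)
  qed
  have "P j \<subseteq> T" if "j < J" for j
  proof
    fix z assume "z \<in> P j"
    then obtain t e where z: "z = t *\<^sub>R w + e" "2 * real j * l \<le> t" "t \<le> 2 * real j * l + l" "e \<in> F"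
      using P_iff by blast
    have e: "norm e = 1" "0 \<le> e \<bullet> w" "e \<bullet> w \<le> \<alpha>"
      using z by (auto simp: F_def cap_def)
    have "0 \<le> 2 * real j * l" using l by simp
    then have t0: "0 \<le> t" using z by linarith
    have "(2 * real j + 1) * l \<le> (2 * real J) * l"
      using that l by (intro mult_right_mono) auto
    then have t1: "t \<le> 4"
      using z J by (simp add: algebra_simps)
    have zw: "z \<bullet> w = t + e \<bullet> w"
      unfolding z by (simp add: inner_add ww)
    have zr: "z - (z \<bullet> w) *\<^sub>R w = e - (e \<bullet> w) *\<^sub>R w"
      unfolding zw unfolding z by (simp add: algebra_simps)
    have sq: "(norm (z - (z \<bullet> w) *\<^sub>R w))\<^sup>2 = 1 - (e \<bullet> w)\<^sup>2"
      unfolding zr norm_reject_sqr[OF w] e(1) by simp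
    have zn: "norm (z - (z \<bullet> w) *\<^sub>R w) \<le> 1"
      by (rule power2_le_imp_le) (simp_all only: sq, simp_all)
    have "z \<in> D"
      using t0 t1 e \<alpha> zw zn by (auto simp: D_def)
    \<comment> \<open>In the shrunken cylinder the squared distance from the axis is at most the
      square of \<open>1 - \<alpha>\<^sup>2\<close>, while for a point of the cap it is at least
      \<open>1 - \<alpha>\<^sup>2\<close> itself, which is larger.\<close>
    moreover have "z \<notin> (\<lambda>x. (1 - \<alpha>\<^sup>2) *\<^sub>R x) ` D"
    proof
      assume "z \<in> (\<lambda>x. (1 - \<alpha>\<^sup>2) *\<^sub>R x) ` D"
      then obtain x where x: "x \<in> D" "z = (1 - \<alpha>\<^sup>2) *\<^sub>R x" by auto
      have r: "0 < 1 - \<alpha>\<^sup>2" "1 - \<alpha>\<^sup>2 < 1"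
        using \<alpha> by (auto simp: power_less_one_iff)
      have "z - (z \<bullet> w) *\<^sub>R w = (1 - \<alpha>\<^sup>2) *\<^sub>R (x - (x \<bullet> w) *\<^sub>R w)"
        unfolding x by (simp add: algebra_simps)
      then have "norm (z - (z \<bullet> w) *\<^sub>R w) = (1 - \<alpha>\<^sup>2) * norm (x - (x \<bullet> w) *\<^sub>R w)"
        using r by simp
      also have "\<dots> \<le> (1 - \<alpha>\<^sup>2) * 1"
        using x r by (intro mult_left_mono) (auto simp: D_def)
      finally have "(norm (z - (z \<bullet> w) *\<^sub>R w))\<^sup>2 \<le> (1 - \<alpha>\<^sup>2)\<^sup>2"
        by (intro power_mono) auto
      moreover have "(1 - \<alpha>\<^sup>2)\<^sup>2 < 1 - \<alpha>\<^sup>2"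
        using r mult_strict_left_mono[of "1 - \<alpha>\<^sup>2" 1 "1 - \<alpha>\<^sup>2"] by (simp add: power2_eq_square)
      moreover have "(e \<bullet> w)\<^sup>2 \<le> \<alpha>\<^sup>2"
        using e by (intro power_mono) auto
      ultimately show False using sq by linarith
    qed
    ultimately show "z \<in> T" by (simp add: T_def)
  qed
  then have UT: "(\<Union>j<J. P j) \<subseteq> T" by auto
  have "J * measure lebesgue K = (\<Sum>j<J. measure lebesgue (P j))"
    by (simp add: P)
  also have "\<dots> = measure lebesgue (\<Union>j<J. P j)"
  proof (rule measure_finite_Union[symmetric])
    show "disjoint_family_on P {..<J}"
      unfolding disjoint_family_on_def using disj by (metis inf_commute linorder_neqE_nat)
    show "emeasure lebesgue (P i) \<noteq> \<infinity>" for i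
      using fmeasurableD2[OF P(1)[of i]] by (metis infinity_ennreal_def)
  qed (use P in \<open>auto intro: fmeasurableD\<close>)
  also have "\<dots> \<le> measure lebesgue T"
    using UT P T by (intro measure_mono_fmeasurable) (auto intro!: fmeasurableD)
  finally have "J * measure lebesgue K \<le> B" using T by simp
  then have "l * (J * measure lebesgue K) \<le> l * B"
    using l by (intro mult_left_mono) auto
  moreover have "1 * measure lebesgue K \<le> (J * l) * measure lebesgue K"
    using J by (intro mult_right_mono) auto
  ultimately have "measure lebesgue K \<le> B * l"
    by (simp add: algebra_simps)
  moreover have "measure lebesgue (swept a w l F) = measure lebesgue K"
    unfolding K_def by (subst swept_translation) (rule measure_translation)
  ultimately show ?thesis
    by (simp add: F_def B_def algebra_simps)
qed

text \<open>Running the motion backwards, from \<open>a + l *\<^sub>R w\<close> in direction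
  \<open>- w\<close>, turns the other half of the cap into a half cap with nonnegative inner
  product; hence the factor 2.\<close>

lemma swept_cap_measure:
  fixes w :: "'a::euclidean_space" and \<alpha> :: real
  assumes w: "norm w = 1" and \<alpha>: "0 < \<alpha>" "\<alpha> < 1" and l: "0 < l" "l \<le> 1"
  shows "measure lebesgue (swept a w l (cap w \<alpha>))
           \<le> 2 * DIM('a) * measure lebesgue (cball (0::'a) 7) * \<alpha>\<^sup>2 * l"
proof -
  let ?F = "\<lambda>w. {e \<in> cap w \<alpha>. 0 \<le> e \<bullet> w}"
  let ?K = "swept a w l (?F w)" and ?L = "swept (a + l *\<^sub>R w) (-w) l (?F (-w))"
  have "swept a w l (cap w \<alpha>) \<subseteq> ?K \<union> ?L"
  proof
    fix z assume "z \<in> swept a w l (cap w \<alpha>)"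
    then obtain t e where *: "0 \<le> t" "t \<le> l" "e \<in> cap w \<alpha>" "z = a + t *\<^sub>R w + e"
      by (auto simp: swept_iff)
    show "z \<in> ?K \<union> ?L"
    proof (cases "0 \<le> e \<bullet> w")
      case True
      then show ?thesis using * by (auto simp: swept_iff)
    next
      case False
      then have "e \<in> ?F (-w)" using * by (auto simp: cap_def)
      moreover have "z = a + l *\<^sub>R w + (l - t) *\<^sub>R (- w) + e"
        using * by (simp add: algebra_simps)
      ultimately have "z \<in> ?L"
        unfolding swept_iff using *(1,2) by (intro exI[of _ "l - t"] exI[of _ e]) auto
      then show ?thesis ..
    qed
  qed
  moreover have m: "?K \<in> lmeasurable" "?L \<in> lmeasurable" "swept a w l (cap w \<alpha>) \<in> lmeasurable"
    by (intro lmeasurable_compact compact_swept compact_half_cap compact_cap)+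
  ultimately have "measure lebesgue (swept a w l (cap w \<alpha>)) \<le> measure lebesgue (?K \<union> ?L)"
    by (intro measure_mono_fmeasurable) (auto intro: fmeasurableD)
  also have "\<dots> \<le> measure lebesgue ?K + measure lebesgue ?L"
    using m by (intro measure_Un_le) (auto intro: fmeasurableD)
  also have "\<dots> \<le> 2 * DIM('a) * measure lebesgue (cball (0::'a) 7) * \<alpha>\<^sup>2 * l"
    using swept_half_cap_measure[OF w \<alpha> l, of a] swept_half_cap_measure[of "-w", OF _ \<alpha> l, of "a + l *\<^sub>R w"] w
    by simp
  finally show ?thesis .
qed

section \<open>Replacing segments by fine zigzags\<close>

definition tube :: "'a::euclidean_space \<Rightarrow> 'a \<Rightarrow> real \<Rightarrow> 'a set" where
  "tube a b \<delta> = (\<Union>x\<in>closed_segment a b. cball x \<delta>)"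

lemma closed_segment_subset_tube: "0 \<le> \<delta> \<Longrightarrow> closed_segment a b \<subseteq> tube a b \<delta>"
  by (force simp: tube_def)

lemma tube_mono: "\<delta> \<le> \<delta>' \<Longrightarrow> tube a b \<delta> \<subseteq> tube a b \<delta>'"
  by (force simp: tube_def)

lemma tube_trans:
  assumes "closed_segment c d \<subseteq> tube a b \<delta>"
  shows "tube c d \<delta>' \<subseteq> tube a b (\<delta> + \<delta>')"
proof
  fix z assume "z \<in> tube c d \<delta>'"
  then obtain x where x: "x \<in> closed_segment c d" "dist x z \<le> \<delta>'"
    by (auto simp: tube_def)
  then obtain y where y: "y \<in> closed_segment a b" "dist y x \<le> \<delta>"
    using assms by (auto simp: tube_def)
  have "dist y z \<le> \<delta> + \<delta>'"
    using x y dist_triangle[of y z x] by linarith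
  then show "z \<in> tube a b (\<delta> + \<delta>')"
    using y by (auto simp: tube_def)
qed

lemma short_segment_subset_tube:
  assumes "p \<in> closed_segment a b" "p = c \<or> p = d" "dist c d \<le> \<delta>"
  shows "closed_segment c d \<subseteq> tube a b \<delta>"
proof
  fix z assume "z \<in> closed_segment c d"
  then have "dist p z \<le> dist c d"
    using assms(2) dist_in_closed_segment[of z c d] by (auto simp: dist_commute)
  then show "z \<in> tube a b \<delta>"
    using assms by (auto simp: tube_def intro!: bexI[of _ p])
qed

section \<open>Coverings of what a path carries, and their cost\<close>

lemma compact_outer_open:
  fixes K :: "'a::euclidean_space set"
  assumes "compact K" "0 < s"
  obtains U where "open U" "U \<in> lmeasurable" "K \<subseteq> U" "measure lebesgue U \<le> measure lebesgue K + s"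
proof -
  have K: "K \<in> lmeasurable"
    using assms by (auto intro: lmeasurable_compact)
  obtain U where U: "open U" "K \<subseteq> U" "U - K \<in> lmeasurable" "emeasure lebesgue (U - K) < ennreal s"
    using sets_lebesgue_outer_open[OF fmeasurableD[OF K] assms(2)] by blast
  have UK: "U = K \<union> (U - K)" using U by auto
  have "measure lebesgue (U - K) \<le> s"
    using U assms by (simp add: emeasure_eq_measure2 ennreal_less_iff)
  then have "measure lebesgue U \<le> measure lebesgue K + s"
    using measure_Un_le[of K lebesgue "U - K"] K U UK by (metis add_left_mono fmeasurableD order_trans)
  moreover have "U \<in> lmeasurable"
    using K U UK by (metis fmeasurable.Un)
  ultimately show ?thesis using U that by blast
qed

text \<open>The label \<open>\<phi>\<close> of a segment determines the part \<open>R \<phi>\<close> of the sphere that is carried along it. The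
  condition on the transitive closure says that the segments in \<open>F\<close> contain a polygonal path from
  \<open>a\<close> to \<open>b\<close>.\<close>

definition refinable ::
  "(real \<Rightarrow> 'a::euclidean_space set) \<Rightarrow> ('a \<Rightarrow> 'a \<Rightarrow> bool) \<Rightarrow> real \<Rightarrow> 'a \<Rightarrow> 'a \<Rightarrow> bool" where
  "refinable R Q M a b \<longleftrightarrow> (\<exists>F U. finite F \<and> (a, b) \<in> {(c, d). \<exists>\<phi>. (c, d, \<phi>) \<in> F}\<^sup>* \<and>
     open U \<and> U \<in> lmeasurable \<and> measure lebesgue U \<le> M \<and>
     (\<forall>(c, d, \<phi>) \<in> F. Q c d \<and> (\<forall>q\<in>closed_segment c d. \<forall>e\<in>R \<phi>. q + e \<in> U)))"

lemma refinable_mono: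
  assumes "refinable R Q M a b" "\<And>\<phi>. R' \<phi> \<subseteq> R \<phi>" "\<And>c d. Q c d \<Longrightarrow> Q' c d" "M \<le> M'"
  shows "refinable R' Q' M' a b"
proof -
  obtain F U where "finite F" "(a, b) \<in> {(c, d). \<exists>\<phi>. (c, d, \<phi>) \<in> F}\<^sup>*" "open U" "U \<in> lmeasurable"
    "measure lebesgue U \<le> M" and
    *: "\<forall>(c, d, \<phi>) \<in> F. Q c d \<and> (\<forall>q\<in>closed_segment c d. \<forall>e\<in>R \<phi>. q + e \<in> U)"
    using assms(1) unfolding refinable_def by blast
  moreover have "\<forall>(c, d, \<phi>) \<in> F. Q' c d \<and> (\<forall>q\<in>closed_segment c d. \<forall>e\<in>R' \<phi>. q + e \<in> U)"
    using * assms(2,3) by fastforce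
  ultimately show ?thesis
    unfolding refinable_def using assms(4) by (intro exI[of _ F] exI[of _ U]) auto
qed

lemma refinable_refl: "0 \<le> M \<Longrightarrow> refinable R Q M a a"
  unfolding refinable_def by (intro exI[of _ "{}"]) auto

lemma refinable_trans:
  assumes "refinable R Q M a b" "refinable R Q M' b c"
  shows "refinable R Q (M + M') a c"
proof -
  obtain F U where F: "finite F" "(a, b) \<in> {(c, d). \<exists>\<phi>. (c, d, \<phi>) \<in> F}\<^sup>*" and
    U: "open U" "U \<in> lmeasurable" "measure lebesgue U \<le> M" and
    FU: "\<forall>(c, d, \<phi>) \<in> F. Q c d \<and> (\<forall>q\<in>closed_segment c d. \<forall>e\<in>R \<phi>. q + e \<in> U)"
    using assms(1) unfolding refinable_def by blast
  obtain F' U' where F': "finite F'" "(b, c) \<in> {(c, d). \<exists>\<phi>. (c, d, \<phi>) \<in> F'}\<^sup>*" and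
    U': "open U'" "U' \<in> lmeasurable" "measure lebesgue U' \<le> M'" and
    FU': "\<forall>(c, d, \<phi>) \<in> F'. Q c d \<and> (\<forall>q\<in>closed_segment c d. \<forall>e\<in>R \<phi>. q + e \<in> U')"
    using assms(2) unfolding refinable_def by blast
  let ?G = "{(c, d). \<exists>\<phi>. (c, d, \<phi>) \<in> F \<union> F'}"
  have "(a, b) \<in> ?G\<^sup>*" "(b, c) \<in> ?G\<^sup>*"
    using F(2) F'(2) by (auto elim!: set_mp[OF rtrancl_mono, rotated])
  then have "(a, c) \<in> ?G\<^sup>*" by (rule rtrancl_trans)
  moreover have "measure lebesgue (U \<union> U') \<le> M + M'"
    using measure_Un_le[of U lebesgue U'] U U' by (simp add: fmeasurableD)
  moreover have "\<forall>(c, d, \<phi>) \<in> F \<union> F'. Q c d \<and> (\<forall>q\<in>closed_segment c d. \<forall>e\<in>R \<phi>. q + e \<in> U \<union> U')"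
    using FU FU' by fastforce
  ultimately show ?thesis
    unfolding refinable_def using F(1) F'(1) U U'
    by (intro exI[of _ "F \<union> F'"] exI[of _ "U \<union> U'"]) auto
qed

lemma refinable_chain:
  assumes "\<And>j. j < m \<Longrightarrow> refinable R Q M (f j) (f (Suc j))"
  shows "refinable R Q (real m * M) (f 0) (f m)"
  using assms
proof (induction m)
  case 0
  show ?case by (simp add: refinable_refl)
next
  case (Suc m)
  then have "refinable R Q (real m * M + M) (f 0) (f (Suc m))"
    by (intro refinable_trans[of _ _ _ _ "f m"]) auto
  then show ?case by (simp add: algebra_simps)
qed

text \<open>\<open>C\<close> is a cost per unit length. Start, length, tube radius and slack are all
  universally quantified because a step of the recursion applies the property to many tiny pieces,
  which share one slack and one tube. \<open>W\<close> keeps all new directions in the chosen plane,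
  so that the pieces can be refined again.\<close>

definition sweepable :: "'a::euclidean_space set \<Rightarrow> 'a \<Rightarrow> real \<Rightarrow> (real \<Rightarrow> 'a set) \<Rightarrow> bool" where
  "sweepable W w C R \<longleftrightarrow> (\<forall>a l \<delta> s. 0 \<le> l \<and> l \<le> 1 \<and> 0 < \<delta> \<and> 0 < s \<longrightarrow>
     refinable R (\<lambda>c d. closed_segment c d \<subseteq> tube a (a + l *\<^sub>R w) \<delta> \<and> d - c \<in> W)
       (C * l + s) a (a + l *\<^sub>R w))"

lemma sweepable_mono:
  assumes "sweepable W w C R" "C \<le> C'" "\<And>\<phi>. R' \<phi> \<subseteq> R \<phi>"
  shows "sweepable W w C' R'"
  unfolding sweepable_def
proof (intro allI impI, elim conjE)
  fix a :: 'a and l \<delta> s :: real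
  assume *: "0 \<le> l" "l \<le> 1" "0 < \<delta>" "0 < s"
  then have "refinable R (\<lambda>c d. closed_segment c d \<subseteq> tube a (a + l *\<^sub>R w) \<delta> \<and> d - c \<in> W) (C * l + s) a (a + l *\<^sub>R w)"
    using assms(1) unfolding sweepable_def by blast
  then show "refinable R' (\<lambda>c d. closed_segment c d \<subseteq> tube a (a + l *\<^sub>R w) \<delta> \<and> d - c \<in> W) (C' * l + s) a (a + l *\<^sub>R w)"
    by (rule refinable_mono) (use assms(2,3) * in \<open>auto intro: mult_right_mono\<close>)
qed

text \<open>This ends the recursion: a label for which nothing remains to be carried allows the
  segment itself to stand, with the empty set as \<open>U\<close>.\<close>

lemma sweepable_leaf:
  assumes "subspace W" "w \<in> W" "R \<phi> = {}"
  shows "sweepable W w 0 R"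
  unfolding sweepable_def refinable_def
proof (intro allI impI, elim conjE)
  fix a :: 'a and l \<delta> s :: real
  assume "0 < \<delta>" "0 < s"
  then show "\<exists>F U. finite F \<and> (a, a + l *\<^sub>R w) \<in> {(c, d). \<exists>\<phi>. (c, d, \<phi>) \<in> F}\<^sup>* \<and>
     open U \<and> U \<in> lmeasurable \<and> measure lebesgue U \<le> 0 * l + s \<and>
     (\<forall>(c, d, \<phi>) \<in> F. (closed_segment c d \<subseteq> tube a (a + l *\<^sub>R w) \<delta> \<and> d - c \<in> W) \<and>
        (\<forall>q\<in>closed_segment c d. \<forall>e\<in>R \<phi>. q + e \<in> U))"
    using assms closed_segment_subset_tube[of \<delta> a "a + l *\<^sub>R w"]
    by (intro exI[of _ "{(a, a + l *\<^sub>R w, \<phi>)}"] exI[of _ "{}"])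
      (auto intro!: r_into_rtrancl simp: subspace_scale)
qed

text \<open>A segment in direction \<open>w\<close> is replaced by a fine zigzag in the directions \<open>w'\<close> and \<open>w''\<close>.
  The cap of points where the sphere is almost tangent to \<open>w\<close> sweeps out little along the segment,
  hence also along anything sufficiently close to it.\<close>

lemma sweepable_step:
  fixes w w' w'' :: "'a::euclidean_space" and \<alpha> \<nu> \<mu> :: real
  assumes w: "norm w = 1" and w': "norm w' = 1" and w'': "norm w'' = 1"
    and \<alpha>: "0 < \<alpha>" "\<alpha> < 1"
    and comb: "w = \<nu> *\<^sub>R w' + \<mu> *\<^sub>R w''" "0 \<le> \<nu>" "0 \<le> \<mu>" and C: "0 \<le> C"
    and sw': "sweepable W w' C R'" and sw'': "sweepable W w'' C R''"
    and R': "\<And>\<phi>. R \<phi> \<subseteq> R' \<phi> \<union> cap w \<alpha>" and R'': "\<And>\<phi>. R \<phi> \<subseteq> R'' \<phi> \<union> cap w \<alpha>"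
  shows "sweepable W w (2 * DIM('a) * measure lebesgue (cball (0::'a) 7) * \<alpha>\<^sup>2 + C * (\<nu> + \<mu>)) R"
  unfolding sweepable_def
proof (intro allI impI, elim conjE)
  fix a :: 'a and l \<delta> s :: real
  assume l: "0 \<le> l" "l \<le> 1" and \<delta>: "0 < \<delta>" and s: "0 < s"
  define b where "b = a + l *\<^sub>R w"
  define \<omega> where "\<omega> = 2 * DIM('a) * measure lebesgue (cball (0::'a) 7) * \<alpha>\<^sup>2"
  define Q where "Q = (\<lambda>c d. closed_segment c d \<subseteq> tube a b \<delta> \<and> d - c \<in> W)"
  have \<omega>: "0 \<le> \<omega>" by (simp add: \<omega>_def)
  have "refinable R Q ((\<omega> + C * (\<nu> + \<mu>)) * l + s) a b"
  proof (cases "l = 0")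
    case True
    then show ?thesis using s by (simp add: b_def refinable_refl)
  next
    case False
    then have l0: "0 < l" using l by simp
    define K where "K = swept a w l (cap w \<alpha>)"
    have cK: "compact K"
      unfolding K_def by (intro compact_swept compact_cap)
    have mK: "measure lebesgue K \<le> \<omega> * l"
      unfolding K_def \<omega>_def using swept_cap_measure[OF w \<alpha> l0 l(2)] by simp
    obtain U where U: "open U" "U \<in> lmeasurable" "K \<subseteq> U" "measure lebesgue U \<le> measure lebesgue K + s / 2"
      using compact_outer_open[OF cK, of "s / 2"] s by auto
    \<comment> \<open>Compactness turns outer regularity into a positive distance: any path in the
      tube of radius \<open>\<delta>0\<close> carries the cap inside \<open>U\<close>, however often
      it is refined.\<close>
    obtain \<delta>0 where \<delta>0: "0 < \<delta>0" "(\<Union>x\<in>K. cball x \<delta>0) \<subseteq> U"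
      using compact_subset_open_imp_cball_epsilon_subset[OF cK U(1,3)] by blast
    have nearK: "q + e \<in> U" if "q \<in> tube a b \<delta>0" "e \<in> cap w \<alpha>" for q e
    proof -
      obtain p where p: "p \<in> closed_segment a b" "dist p q \<le> \<delta>0"
        using \<open>q \<in> tube a b \<delta>0\<close> by (auto simp: tube_def)
      obtain t where t: "0 \<le> t" "t \<le> 1" "p = a + t *\<^sub>R (b - a)"
        using p(1) by (auto simp: in_segment algebra_simps)
      have "p + e \<in> K"
        unfolding K_def swept_iff using that(2) t l
        by (intro exI[of _ "t * l"] exI[of _ e]) (auto simp: b_def mult_left_le_one_le)
      moreover have "q + e \<in> cball (p + e) \<delta>0"
        using p(2) by (simp add: dist_norm)
      ultimately show ?thesis using \<delta>0(2) by blast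
    qed
    define \<delta>1 where "\<delta>1 = min \<delta> \<delta>0"
    define h where "h = min 1 (\<delta>1 / 2)"
    have h: "0 < h" "h \<le> 1" "h \<le> \<delta>1 / 2" "0 < \<delta>1" "\<delta>1 \<le> \<delta>" "\<delta>1 \<le> \<delta>0"
      using \<delta> \<delta>0 by (auto simp: h_def \<delta>1_def)
    obtain N :: nat where N: "l * (\<nu> + \<mu>) / h < real N"
      using reals_Archimedean2 by blast
    define m where "m = Suc N"
    have m: "0 < real m" "l * (\<nu> + \<mu>) / m \<le> h"
      using N h by (auto simp: m_def field_simps)
    \<comment> \<open>One of \<open>m\<close> equal pieces of the segment is the sum of steps of
      length \<open>x\<close> and \<open>y\<close> in the two new directions. Since
      \<open>x + y\<close> is at most \<open>\<delta>1 / 2\<close>, the tooth uses half of the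
      permitted radius; the other half is left for its own refinement.\<close>
    define x where "x = l * \<nu> / m"
    define y where "y = l * \<mu> / m"
    have xy: "0 \<le> x" "0 \<le> y" "x + y \<le> h"
      using m l comb by (auto simp: x_def y_def field_simps)
    define f where "f j = a + (real j * l / m) *\<^sub>R w" for j
    have f_seg: "f j \<in> closed_segment a b" if "j \<le> m" for j
    proof -
      have "f j = (1 - real j / m) *\<^sub>R a + (real j / m) *\<^sub>R b"
        by (simp add: f_def b_def algebra_simps)
      then show ?thesis
        unfolding in_segment using that m by (intro exI[of _ "real j / m"]) auto
    qed
    \<comment> \<open>The cap is already paid for by \<open>U\<close>; what remains lies both in
      \<open>R' \<phi>\<close> and in \<open>R'' \<phi>\<close>.\<close>
    let ?R = "\<lambda>\<phi>. R \<phi> - cap w \<alpha>"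
    let ?Q = "\<lambda>c d. closed_segment c d \<subseteq> tube a b \<delta>1 \<and> d - c \<in> W"
    \<comment> \<open>Half of the slack \<open>s\<close> went into \<open>U\<close>. The other half
      is shared by the two sides of each of the \<open>m\<close> teeth, \<open>s / (4 * m)\<close>
      for each side.\<close>
    have piece: "refinable ?R ?Q (C * (x + y) + s / (2 * m)) (f j) (f (Suc j))" if j: "j < m" for j
    proof -
      let ?g = "f j + x *\<^sub>R w'"
      have end_eq: "?g + y *\<^sub>R w'' = f (Suc j)"
      proof -
        have "x *\<^sub>R w' + y *\<^sub>R w'' = (l / m) *\<^sub>R w"
          unfolding comb(1) x_def y_def by (simp add: algebra_simps)
        moreover have "f (Suc j) = f j + (l / m) *\<^sub>R w"
          unfolding f_def using m by (simp add: field_simps flip: scaleR_left_distrib)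
        ultimately show ?thesis by (simp add: add.assoc)
      qed
      have sub: "closed_segment c d \<subseteq> tube a b \<delta>1"
        if cd: "closed_segment c d \<subseteq> tube u v (\<delta>1 / 2)" and uv: "closed_segment u v \<subseteq> tube a b (\<delta>1 / 2)"
        for c d u v
        using cd tube_trans[OF uv, of "\<delta>1 / 2"] by simp
      have A: "refinable R' (\<lambda>c d. closed_segment c d \<subseteq> tube (f j) ?g (\<delta>1 / 2) \<and> d - c \<in> W)
          (C * x + s / (4 * m)) (f j) ?g"
        using sw' xy h s m unfolding sweepable_def by simp
      have B: "closed_segment (f j) ?g \<subseteq> tube a b (\<delta>1 / 2)"
        using xy h w' j by (intro short_segment_subset_tube[OF f_seg[of j]]) (auto simp: dist_norm)
      have 1: "refinable ?R ?Q (C * x + s / (4 * m)) (f j) ?g"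
        by (rule refinable_mono[OF A]) (use R' sub[OF _ B] in auto)
      have A': "refinable R'' (\<lambda>c d. closed_segment c d \<subseteq> tube ?g (?g + y *\<^sub>R w'') (\<delta>1 / 2) \<and> d - c \<in> W)
          (C * y + s / (4 * m)) ?g (?g + y *\<^sub>R w'')"
        using sw'' xy h s m unfolding sweepable_def by simp
      have B': "closed_segment ?g (?g + y *\<^sub>R w'') \<subseteq> tube a b (\<delta>1 / 2)"
      proof (rule short_segment_subset_tube)
        show "f (Suc j) \<in> closed_segment a b"
          using f_seg j by simp
        show "f (Suc j) = ?g \<or> f (Suc j) = ?g + y *\<^sub>R w''"
          by (simp only: end_eq) simp
        have "dist ?g (?g + y *\<^sub>R w'') = y"
          using w'' xy by (simp add: dist_norm)
        then show "dist ?g (?g + y *\<^sub>R w'') \<le> \<delta>1 / 2"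
          using xy h by linarith
      qed
      have 2: "refinable ?R ?Q (C * y + s / (4 * m)) ?g (?g + y *\<^sub>R w'')"
        by (rule refinable_mono[OF A']) (use R'' sub[OF _ B'] in auto)
      have sum_eq: "C * x + s / (4 * m) + (C * y + s / (4 * m)) = C * (x + y) + s / (2 * m)"
        using m by (simp add: field_simps)
      then show ?thesis
        using refinable_trans[OF 1 2] by (simp only: end_eq sum_eq)
    qed
    have "refinable ?R ?Q (real m * (C * (x + y) + s / (2 * m))) (f 0) (f m)"
      by (rule refinable_chain) (rule piece)
    moreover have "f 0 = a" "f m = b"
      using m by (auto simp: f_def b_def)
    moreover have "real m * (C * (x + y) + s / (2 * m)) = C * (\<nu> + \<mu>) * l + s / 2"
      using m by (simp add: x_def y_def field_simps)
    ultimately have "refinable ?R ?Q (C * (\<nu> + \<mu>) * l + s / 2) a b" by simp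
    then obtain F V where F: "finite F" "(a, b) \<in> {(c, d). \<exists>\<phi>. (c, d, \<phi>) \<in> F}\<^sup>*" and
      V: "open V" "V \<in> lmeasurable" "measure lebesgue V \<le> C * (\<nu> + \<mu>) * l + s / 2" and
      FV: "\<forall>(c, d, \<phi>) \<in> F. ?Q c d \<and> (\<forall>q\<in>closed_segment c d. \<forall>e\<in>?R \<phi>. q + e \<in> V)"
      unfolding refinable_def by blast
    have "measure lebesgue (U \<union> V) \<le> (\<omega> + C * (\<nu> + \<mu>)) * l + s"
      using measure_Un_le[of U lebesgue V] U V mK by (simp add: fmeasurableD algebra_simps)
    moreover have "\<forall>(c, d, \<phi>) \<in> F. Q c d \<and> (\<forall>q\<in>closed_segment c d. \<forall>e\<in>R \<phi>. q + e \<in> U \<union> V)"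
    proof clarify
      fix c d \<phi> assume "(c, d, \<phi>) \<in> F"
      then have *: "closed_segment c d \<subseteq> tube a b \<delta>1" "d - c \<in> W"
        and **: "\<And>q e. q \<in> closed_segment c d \<Longrightarrow> e \<in> R \<phi> - cap w \<alpha> \<Longrightarrow> q + e \<in> V"
        using FV by auto
      show "Q c d \<and> (\<forall>q\<in>closed_segment c d. \<forall>e\<in>R \<phi>. q + e \<in> U \<union> V)"
        using * ** nearK tube_mono[OF h(5), of a b] tube_mono[OF h(6), of a b]
        unfolding Q_def by blast
    qed
    ultimately show ?thesis
      unfolding refinable_def using F U V
      by (intro exI[of _ F] exI[of _ "U \<union> V"]) auto
  qed
  then show "refinable R (\<lambda>c d. closed_segment c d \<subseteq> tube a (a + l *\<^sub>R w) \<delta> \<and> d - c \<in> W)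
     ((2 * DIM('a) * measure lebesgue (cball (0::'a) 7) * \<alpha>\<^sup>2 + C * (\<nu> + \<mu>)) * l + s) a (a + l *\<^sub>R w)"
    by (simp add: Q_def \<omega>_def b_def)
qed

section \<open>Directions in a plane\<close>

locale orthonormal_pair =
  fixes e1 e2 :: "'a::euclidean_space"
  assumes e1: "norm e1 = 1" and e2: "norm e2 = 1" and e12: "e1 \<bullet> e2 = 0"
begin

definition dir :: "real \<Rightarrow> 'a" where
  "dir \<theta> = cos \<theta> *\<^sub>R e1 + sin \<theta> *\<^sub>R e2"

lemma inner_dir_dir: "dir \<theta> \<bullet> dir \<phi> = cos (\<theta> - \<phi>)"
  using e1 e2 e12 by (simp add: dir_def inner_add norm_eq_1 inner_commute cos_diff)

lemma norm_dir [simp]: "norm (dir \<theta>) = 1"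
  by (simp add: norm_eq_1 inner_dir_dir)

lemma dir_in_span: "dir \<theta> \<in> span {e1, e2}"
  unfolding dir_def by (intro span_add span_scale span_base) auto

lemma dir_add_pi: "dir (\<theta> + pi) = - dir \<theta>"
  by (simp add: dir_def)

lemma dist_dir_le: "norm (dir \<theta> - dir \<phi>) \<le> \<bar>\<theta> - \<phi>\<bar>"
proof (rule power2_le_imp_le)
  have "(norm (dir \<theta> - dir \<phi>))\<^sup>2 = 2 - 2 * cos (\<theta> - \<phi>)"
    unfolding power2_norm_eq_inner by (simp add: inner_diff inner_dir_dir inner_commute cos_diff algebra_simps)
  also have "\<dots> = 4 * (sin ((\<theta> - \<phi>) / 2))\<^sup>2"
  proof -
    have "cos (\<theta> - \<phi>) = cos (2 * ((\<theta> - \<phi>) / 2))"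
      by (rule arg_cong[where f = cos]) (simp add: field_simps)
    also have "\<dots> = 1 - 2 * (sin ((\<theta> - \<phi>) / 2))\<^sup>2" by (rule cos_double_sin)
    finally show ?thesis by simp
  qed
  also have "\<dots> = (2 * \<bar>sin ((\<theta> - \<phi>) / 2)\<bar>)\<^sup>2"
    by (simp add: power2_eq_square)
  also have "\<dots> \<le> \<bar>\<theta> - \<phi>\<bar>\<^sup>2"
    using abs_sin_x_le_abs_x[of "(\<theta> - \<phi>) / 2"] by (intro power_mono) auto
  finally show "(norm (dir \<theta> - dir \<phi>))\<^sup>2 \<le> \<bar>\<theta> - \<phi>\<bar>\<^sup>2" .
qed simp

lemma span_polar:
  assumes "v \<in> span {e1, e2}"
  obtains \<theta> where "v = norm v *\<^sub>R dir \<theta>"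
proof -
  obtain x y where v: "v = x *\<^sub>R e1 + y *\<^sub>R e2"
    using assms by (auto simp: span_insert span_singleton) (metis add.commute diff_add_cancel)
  have nv: "(norm v)\<^sup>2 = x\<^sup>2 + y\<^sup>2"
    unfolding power2_norm_eq_inner v using e1 e2 e12
    by (simp add: inner_add norm_eq_1 inner_commute power2_eq_square)
  show ?thesis
  proof (cases "v = 0")
    case False
    then have "(x / norm v)\<^sup>2 + (y / norm v)\<^sup>2 = 1"
      by (simp only: power_divide add_divide_distrib[symmetric] nv[symmetric]) simp
    then obtain t where "x / norm v = cos t" "y / norm v = sin t"
      using sincos_total_2pi by metis
    then have "x = norm v * cos t" "y = norm v * sin t"
      using False by (auto simp: field_simps)
    then have "v = norm v *\<^sub>R dir t"
      by (subst v) (simp add: dir_def scaleR_add_right)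
    then show ?thesis by (rule that)
  qed (use that[of 0] in auto)
qed

text \<open>Cramer's rule for \<open>dir r\<close> in the basis \<open>dir p\<close>,
  \<open>dir q\<close>, with \<open>p = l + \<alpha>\<close> and
  \<open>q = l + \<gamma> - \<alpha>\<close>. Both ends of the arc lie outside the angle from
  \<open>p\<close> to \<open>q\<close>, so one coefficient would be negative; reversing
  \<open>dir q\<close> repairs this. The same two directions with the same weights serve both ends,
  hence the recursion closes on the two families \<open>dir l\<close> and
  \<open>- dir (l + \<gamma>)\<close>.\<close>

lemma dir_split:
  fixes l \<gamma> \<alpha> :: real
  assumes "sin (\<gamma> - 2 * \<alpha>) \<noteq> 0"
  shows "dir l = (sin (\<gamma> - \<alpha>) / sin (\<gamma> - 2 * \<alpha>)) *\<^sub>R dir (l + \<alpha>)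
           + (sin \<alpha> / sin (\<gamma> - 2 * \<alpha>)) *\<^sub>R (- dir (l + \<gamma> - \<alpha>))" (is ?A)
    and "- dir (l + \<gamma>) = (sin (\<gamma> - \<alpha>) / sin (\<gamma> - 2 * \<alpha>)) *\<^sub>R (- dir (l + \<gamma> - \<alpha>))
           + (sin \<alpha> / sin (\<gamma> - 2 * \<alpha>)) *\<^sub>R dir (l + \<alpha>)" (is ?B)
proof -
  have split: "sin (q - p) *\<^sub>R dir r = sin (q - r) *\<^sub>R dir p + sin (r - p) *\<^sub>R dir q" for p q r
  proof -
    have "sin (q - p) * cos r = sin (q - r) * cos p + sin (r - p) * cos q"
      "sin (q - p) * sin r = sin (q - r) * sin p + sin (r - p) * sin q"
      by (simp_all add: sin_diff algebra_simps)
    then show ?thesis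
      by (simp add: dir_def scaleR_add_right flip: scaleR_add_left)
        (simp add: scaleR_add_left add_ac)
  qed
  have solve: "x = (p / k) *\<^sub>R y + (q / k) *\<^sub>R z" if "k *\<^sub>R x = p *\<^sub>R y + q *\<^sub>R z" "k \<noteq> 0"
    for x y z :: 'a and p q k :: real
  proof -
    have "x = inverse k *\<^sub>R (k *\<^sub>R x)" using that(2) by simp
    also have "\<dots> = inverse k *\<^sub>R (p *\<^sub>R y + q *\<^sub>R z)" by (simp only: that(1))
    finally show ?thesis by (simp add: scaleR_add_right divide_inverse mult.commute)
  qed
  have "sin (\<gamma> - 2 * \<alpha>) *\<^sub>R dir l = sin (\<gamma> - \<alpha>) *\<^sub>R dir (l + \<alpha>) + sin \<alpha> *\<^sub>R (- dir (l + \<gamma> - \<alpha>))"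
    using split[of "l + \<gamma> - \<alpha>" "l + \<alpha>" l] by (simp add: algebra_simps)
  then show ?A by (rule solve) (rule assms)
  have "sin (\<gamma> - 2 * \<alpha>) *\<^sub>R (- dir (l + \<gamma>)) = sin (\<gamma> - \<alpha>) *\<^sub>R (- dir (l + \<gamma> - \<alpha>)) + sin \<alpha> *\<^sub>R dir (l + \<alpha>)"
    using split[of "l + \<gamma> - \<alpha>" "l + \<alpha>" "l + \<gamma>"] by (simp add: algebra_simps)
  then show ?B by (rule solve) (rule assms)
qed

text \<open>Sum to product in the numerator and double angle in the denominator share the factor
  \<open>cos ((\<gamma> - 2 * \<alpha>) / 2)\<close>. The half-angle form is the one in which the
  growth of length telescopes.\<close>

lemma split_weights:
  fixes \<gamma> \<alpha> :: real
  assumes "0 < \<gamma> - 2 * \<alpha>" "0 < \<alpha>" "\<gamma> \<le> pi"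
  shows "sin (\<gamma> - \<alpha>) / sin (\<gamma> - 2 * \<alpha>) + sin \<alpha> / sin (\<gamma> - 2 * \<alpha>) = sin (\<gamma> / 2) / sin ((\<gamma> - 2 * \<alpha>) / 2)"
proof -
  have pos: "0 < sin ((\<gamma> - 2 * \<alpha>) / 2)" "0 < sin (\<gamma> - 2 * \<alpha>)" "0 < cos ((\<gamma> - 2 * \<alpha>) / 2)"
    using assms by (auto intro!: sin_gt_zero cos_gt_zero)
  have "sin (\<gamma> - \<alpha>) + sin \<alpha> = 2 * sin (\<gamma> / 2) * cos ((\<gamma> - 2 * \<alpha>) / 2)"
    using sin_plus_sin[of "\<gamma> - \<alpha>" \<alpha>] by (simp add: mult.assoc)
  moreover have "sin (\<gamma> - 2 * \<alpha>) = 2 * sin ((\<gamma> - 2 * \<alpha>) / 2) * cos ((\<gamma> - 2 * \<alpha>) / 2)"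
    unfolding mult.assoc[symmetric] sin_double[symmetric]
    by (rule arg_cong[where f = sin]) (simp add: field_simps)
  ultimately show ?thesis
    using pos by (simp flip: add_divide_distrib)
qed

text \<open>A point \<open>e\<close> of the sphere is its own normal, so these are the points to
  which some direction with angle in \<open>T\<close> is tangent: the part a path running through
  those directions can sweep cheaply.\<close>

definition tangents :: "real set \<Rightarrow> 'a set" where
  "tangents T = {e. norm e = 1 \<and> (\<exists>\<theta>\<in>T. e \<bullet> dir \<theta> = 0)}"

lemma tangents_Un: "tangents (S \<union> T) = tangents S \<union> tangents T"
  by (auto simp: tangents_def)

lemma tangents_mono: "S \<subseteq> T \<Longrightarrow> tangents S \<subseteq> tangents T"
  by (auto simp: tangents_def)

lemma abs_inner_dir_le:
  assumes "norm e = 1" "e \<bullet> dir \<theta> = 0"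
  shows "\<bar>e \<bullet> dir \<phi>\<bar> \<le> \<bar>\<theta> - \<phi>\<bar>"
proof -
  have "\<bar>e \<bullet> dir \<phi>\<bar> = \<bar>e \<bullet> (dir \<theta> - dir \<phi>)\<bar>"
    using assms(2) by (simp add: inner_diff)
  also have "\<dots> \<le> norm e * norm (dir \<theta> - dir \<phi>)"
    by (rule Cauchy_Schwarz_ineq2)
  finally show ?thesis
    using assms(1) dist_dir_le[of \<theta> \<phi>] by simp
qed

lemma tangents_subset_cap:
  assumes "\<And>\<theta>. \<theta> \<in> T \<Longrightarrow> \<bar>\<theta> - \<phi>\<bar> \<le> \<alpha>"
  shows "tangents T \<subseteq> cap (dir \<phi>) \<alpha>"
proof
  fix e assume "e \<in> tangents T"
  then obtain \<theta> where "norm e = 1" "\<theta> \<in> T" "e \<bullet> dir \<theta> = 0"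
    by (auto simp: tangents_def)
  then show "e \<in> cap (dir \<phi>) \<alpha>"
    using abs_inner_dir_le[of e \<theta> \<phi>] assms[of \<theta>] by (simp add: cap_def)
qed

text \<open>\<open>e \<bullet> dir \<theta>\<close> changes sign over a half turn, so it has a zero
  by the intermediate value theorem. A zero at the far end \<open>l + pi\<close> is also one at
  \<open>l\<close>, which permits the half-open interval.\<close>

lemma tangents_total:
  assumes "norm e = 1"
  shows "e \<in> tangents {l..<l + pi}"
proof -
  have "\<exists>\<theta>. l \<le> \<theta> \<and> \<theta> \<le> l + pi \<and> e \<bullet> dir \<theta> = 0"
  proof (cases "e \<bullet> dir l \<le> 0")
    case True
    moreover have "0 \<le> e \<bullet> dir (l + pi)" using True by (simp add: dir_add_pi)
    moreover have "continuous_on {l..l + pi} (\<lambda>\<theta>. e \<bullet> dir \<theta>)"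
      unfolding dir_def by (intro continuous_intros)
    ultimately show ?thesis
      using IVT'[of "\<lambda>\<theta>. e \<bullet> dir \<theta>" l 0 "l + pi"] by simp
  next
    case False
    then have "e \<bullet> dir (l + pi) \<le> 0" by (simp add: dir_add_pi)
    moreover have "continuous_on {l..l + pi} (\<lambda>\<theta>. e \<bullet> dir \<theta>)"
      unfolding dir_def by (intro continuous_intros)
    ultimately show ?thesis
      using IVT2'[of "\<lambda>\<theta>. e \<bullet> dir \<theta>" "l + pi" 0 l] False by simp
  qed
  then obtain \<theta> where \<theta>: "l \<le> \<theta>" "\<theta> \<le> l + pi" "e \<bullet> dir \<theta> = 0" by blast
  then have "e \<bullet> dir l = 0" if "\<theta> = l + pi"
    using that by (simp add: dir_add_pi)
  then show ?thesis
    using \<theta> assms by (cases "\<theta> = l + pi") (auto simp: tangents_def)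
qed

text \<open>The directions already met by a path of the recursion form the complement (modulo \<open>pi\<close>) of an
  arc \<open>{l<..<l + \<gamma>}\<close>, the current direction being one of its ends. Splitting a segment
  turns the arc into \<open>{l + \<alpha><..<l + \<gamma>}\<close> on one part and into \<open>{l<..<l + \<gamma> - \<alpha>}\<close> on the other.
  The path length grows by the factor \<open>sin (\<gamma> / 2) / sin ((\<gamma> - 2 * \<alpha>) / 2)\<close>, so it telescopes.\<close>

lemma sweepable_arc:
  fixes \<epsilon> \<alpha> :: real
  assumes \<alpha>: "0 < \<alpha>" "\<alpha> < 1" "\<alpha> < \<epsilon>" and "\<epsilon> + real j * \<alpha> \<le> pi"
  defines "\<omega> \<equiv> 2 * DIM('a) * measure lebesgue (cball (0::'a) 7) * \<alpha>\<^sup>2"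
  defines "C \<equiv> \<lambda>j. \<omega> * (real j + 1) * (sin ((\<epsilon> + real j * \<alpha>) / 2) * sin ((\<epsilon> + real j * \<alpha> - \<alpha>) / 2))
                     / (sin (\<epsilon> / 2) * sin ((\<epsilon> - \<alpha>) / 2))"
  shows "sweepable (span {e1, e2}) (dir l) (C j)
           (\<lambda>\<phi>. tangents ({l - \<alpha>..<\<phi>} \<union> {\<phi> + \<epsilon><..<l + (\<epsilon> + real j * \<alpha>)}))
       \<and> sweepable (span {e1, e2}) (- dir (l + (\<epsilon> + real j * \<alpha>))) (C j)
           (\<lambda>\<phi>. tangents ({l<..<\<phi>} \<union> {\<phi> + \<epsilon><..l + (\<epsilon> + real j * \<alpha>) + \<alpha>}))"
  using \<open>\<epsilon> + real j * \<alpha> \<le> pi\<close>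
proof (induction j arbitrary: l)
  case 0
  define s where "s = sin (\<epsilon> / 2) * sin ((\<epsilon> - \<alpha>) / 2)"
  have "0 < s"
    unfolding s_def using \<alpha> 0 by (intro mult_pos_pos sin_gt_zero) auto
  then have "sin (\<epsilon> / 2) \<noteq> 0" "sin ((\<epsilon> - \<alpha>) / 2) \<noteq> 0"
    by (auto simp: s_def)
  then have C0: "C 0 = \<omega>"
    unfolding C_def by simp
  \<comment> \<open>At the bottom \<open>sweepable_step\<close> is used degenerately, with all three
    directions equal to \<open>w\<close> and weights 1 and 0: one cap is charged and nothing remains
    for the label \<phi>.\<close>
  have leaf: "sweepable (span {e1, e2}) w \<omega> R"
    if "norm w = 1" "w \<in> span {e1, e2}" "R \<phi> \<subseteq> cap w \<alpha>" for w :: 'a and R and \<phi> :: real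
  proof -
    have "sweepable (span {e1, e2}) w 0 (\<lambda>\<phi>. R \<phi> - cap w \<alpha>)"
      using that by (intro sweepable_leaf[of _ _ _ \<phi>]) auto
    from sweepable_step[OF that(1) that(1) that(1) \<alpha>(1,2), of 1 0, OF _ _ _ _ this this]
    show ?thesis by (auto simp: \<omega>_def)
  qed
  have "tangents ({l - \<alpha>..<l} \<union> {l + \<epsilon><..<l + \<epsilon>}) \<subseteq> cap (dir l) \<alpha>"
    by (rule tangents_subset_cap) auto
  moreover have "tangents ({l<..<l} \<union> {l + \<epsilon><..l + \<epsilon> + \<alpha>}) \<subseteq> cap (- dir (l + \<epsilon>)) \<alpha>"
    using tangents_subset_cap[of "{l<..<l} \<union> {l + \<epsilon><..l + \<epsilon> + \<alpha>}" "l + \<epsilon>" \<alpha>] by (auto simp: cap_def)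
  ultimately show ?case
    unfolding C0 by (intro conjI leaf[where \<phi> = l]) (auto simp: dir_in_span span_neg)
next
  case (Suc j)
  define \<gamma> where "\<gamma> = \<epsilon> + real (Suc j) * \<alpha>"
  define s where "s = sin (\<epsilon> / 2) * sin ((\<epsilon> - \<alpha>) / 2)"
  have \<gamma>: "\<epsilon> + real j * \<alpha> = \<gamma> - \<alpha>" "\<epsilon> + \<alpha> \<le> \<gamma>" "\<gamma> \<le> pi" "\<gamma> - \<alpha> \<le> pi"
    using Suc.prems \<alpha> by (auto simp: \<gamma>_def algebra_simps)
  have s: "0 < s"
    unfolding s_def using \<alpha> \<gamma> pi_gt_zero by (intro mult_pos_pos sin_gt_zero) auto
  have \<omega>: "0 \<le> \<omega>" by (simp add: \<omega>_def)
  \<comment> \<open>Here \<open>\<alpha> < \<epsilon>\<close> enters: it gives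
    \<open>\<gamma> - 2 * \<alpha> \<ge> \<epsilon> - \<alpha> > 0\<close>, so the two new
    directions are independent even at the last split.\<close>
  have sg: "0 < sin (\<gamma> - 2 * \<alpha>)" "0 < sin ((\<gamma> - 2 * \<alpha>) / 2)" "0 < sin ((\<gamma> - \<alpha>) / 2)" "0 < sin (\<gamma> / 2)"
    "0 < sin (\<gamma> - \<alpha>)" "0 < sin \<alpha>"
    using \<gamma> \<alpha> by (auto intro!: sin_gt_zero)
  define \<nu> where "\<nu> = sin (\<gamma> - \<alpha>) / sin (\<gamma> - 2 * \<alpha>)"
  define \<mu> where "\<mu> = sin \<alpha> / sin (\<gamma> - 2 * \<alpha>)"
  have weights: "0 \<le> \<nu>" "0 \<le> \<mu>" "\<nu> + \<mu> = sin (\<gamma> / 2) / sin ((\<gamma> - 2 * \<alpha>) / 2)"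
    using sg split_weights[of \<gamma> \<alpha>] \<gamma> \<alpha> by (auto simp: \<nu>_def \<mu>_def)
  have Cj: "C j = \<omega> * (real j + 1) * (sin ((\<gamma> - \<alpha>) / 2) * sin ((\<gamma> - 2 * \<alpha>) / 2)) / s"
    unfolding C_def s_def \<gamma>(1) by (simp add: algebra_simps)
  define P where "P = \<omega> * (sin (\<gamma> / 2) * sin ((\<gamma> - \<alpha>) / 2)) / s"
  have CS: "C (Suc j) = (real j + 2) * P"
    unfolding P_def C_def s_def \<gamma>_def by (simp add: algebra_simps)
  \<comment> \<open>\<open>P\<close> is the cost of one level when the path is taken at its full
    final length. The \<open>j + 1\<close> levels below are each charged \<open>P\<close>, and the
    present one costs \<omega>, at most \<open>P\<close> by monotonicity of the sine.\<close>
  have "C j * (\<nu> + \<mu>) = (real j + 1) * P"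
    unfolding weights Cj P_def using sg by simp
  moreover have "\<omega> * s / s \<le> P"
    unfolding P_def
  proof (intro divide_right_mono mult_left_mono)
    have "0 < sin ((\<epsilon> - \<alpha>) / 2)"
      using \<gamma> \<alpha> by (intro sin_gt_zero) auto
    then show "s \<le> sin (\<gamma> / 2) * sin ((\<gamma> - \<alpha>) / 2)"
      unfolding s_def using \<gamma> \<alpha> sg by (intro mult_mono sin_monotone_2pi_le) auto
  qed (use s \<omega> in auto)
  ultimately have bound: "\<omega> + C j * (\<nu> + \<mu>) \<le> C (Suc j)"
    unfolding CS using s by (simp add: algebra_simps)
  have Cpos: "0 \<le> C j"
    unfolding Cj using sg s \<omega> by simp
  have sw1: "sweepable (span {e1, e2}) (dir (l + \<alpha>)) (C j)
      (\<lambda>\<phi>. tangents ({l..<\<phi>} \<union> {\<phi> + \<epsilon><..<l + \<gamma>}))"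
    using Suc.IH[of "l + \<alpha>"] \<gamma> by simp
  have sw2: "sweepable (span {e1, e2}) (- dir (l + \<gamma> - \<alpha>)) (C j)
      (\<lambda>\<phi>. tangents ({l<..<\<phi>} \<union> {\<phi> + \<epsilon><..l + \<gamma>}))"
  proof -
    have eqs: "l + (\<epsilon> + real j * \<alpha>) = l + \<gamma> - \<alpha>" "l + \<gamma> - \<alpha> + \<alpha> = l + \<gamma>"
      using \<gamma>(1) by auto
    have "\<epsilon> + real j * \<alpha> \<le> pi" using \<gamma> by simp
    then show ?thesis
      using Suc.IH[of l] unfolding eqs by blast
  qed
  have split1: "dir l = \<nu> *\<^sub>R dir (l + \<alpha>) + \<mu> *\<^sub>R (- dir (l + \<gamma> - \<alpha>))"
    and split2: "- dir (l + \<gamma>) = \<nu> *\<^sub>R (- dir (l + \<gamma> - \<alpha>)) + \<mu> *\<^sub>R dir (l + \<alpha>)"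
    unfolding \<nu>_def \<mu>_def using dir_split[of \<gamma> \<alpha> l] sg by auto
  have capL: "tangents {l - \<alpha>..l} \<subseteq> cap (dir l) \<alpha>"
    by (rule tangents_subset_cap) auto
  have capR: "tangents {l + \<gamma>..l + \<gamma> + \<alpha>} \<subseteq> cap (- dir (l + \<gamma>)) \<alpha>"
    using tangents_subset_cap[of "{l + \<gamma>..l + \<gamma> + \<alpha>}" "l + \<gamma>" \<alpha>] by (auto simp: cap_def)
  \<comment> \<open>The current direction pays for the arc of width \<alpha> that ends at it; the
    rest is inherited from either child. Consecutive directions differ by \<alpha>, so no gap is
    left between their arcs.\<close>
  have L: "tangents ({l - \<alpha>..<\<phi>} \<union> {\<phi> + \<epsilon><..<l + \<gamma>}) \<subseteq> tangents T \<union> cap (dir l) \<alpha>"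
    if "{l<..<\<phi>} \<union> {\<phi> + \<epsilon><..<l + \<gamma>} \<subseteq> T" for \<phi> T
  proof -
    have "{l - \<alpha>..<\<phi>} \<union> {\<phi> + \<epsilon><..<l + \<gamma>} \<subseteq> T \<union> {l - \<alpha>..l}"
      using that by force
    then show ?thesis
      using tangents_mono tangents_Un capL by blast
  qed
  have R: "tangents ({l<..<\<phi>} \<union> {\<phi> + \<epsilon><..l + \<gamma> + \<alpha>}) \<subseteq> tangents T \<union> cap (- dir (l + \<gamma>)) \<alpha>"
    if "{l<..<\<phi>} \<union> {\<phi> + \<epsilon><..<l + \<gamma>} \<subseteq> T" for \<phi> T
  proof -
    have "{l<..<\<phi>} \<union> {\<phi> + \<epsilon><..l + \<gamma> + \<alpha>} \<subseteq> T \<union> {l + \<gamma>..l + \<gamma> + \<alpha>}"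
      using that by force
    then show ?thesis
      using tangents_mono tangents_Un capR by blast
  qed
  have "sweepable (span {e1, e2}) (dir l) (\<omega> + C j * (\<nu> + \<mu>))
      (\<lambda>\<phi>. tangents ({l - \<alpha>..<\<phi>} \<union> {\<phi> + \<epsilon><..<l + \<gamma>}))"
    unfolding \<omega>_def
    by (rule sweepable_step[OF _ _ _ \<alpha>(1,2) split1 weights(1,2) Cpos sw1 sw2]) (simp, simp, simp, (intro L, force)+)
  moreover have "sweepable (span {e1, e2}) (- dir (l + \<gamma>)) (\<omega> + C j * (\<nu> + \<mu>))
      (\<lambda>\<phi>. tangents ({l<..<\<phi>} \<union> {\<phi> + \<epsilon><..l + \<gamma> + \<alpha>}))"
    unfolding \<omega>_def
    by (rule sweepable_step[OF _ _ _ \<alpha>(1,2) split2 weights(1,2) Cpos sw2 sw1]) (simp, simp, simp, (intro R, force)+)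
  ultimately show ?case
    unfolding \<gamma>_def[symmetric] using sweepable_mono[OF _ bound order_refl] by blast
qed

end

section \<open>Refining one segment\<close>

text \<open>Used to bound the length of refined segments and the drift of their starting
  points.\<close>

lemma dist_closed_segment_le:
  fixes u v x y :: "'a::euclidean_space"
  assumes "x \<in> closed_segment u v" "y \<in> closed_segment u v"
  shows "dist x y \<le> dist u v"
  using segment_furthest_le[OF assms(1), of y] dist_in_closed_segment[OF assms(2)]
  by (smt (verit) dist_commute dist_norm)

context orthonormal_pair begin

text \<open>With \<open>N\<close> steps of size \<alpha> below \<open>pi / N\<close>, the
  \<open>N + 1\<close> levels cost at most a constant times \<open>1 / N\<close> in total, since the
  growth is bounded by \<open>1 / S\<close> independently of \<open>N\<close>. The initial arc is a
  whole half turn. A point \<open>e\<close> tangent to \<open>dir \<theta>\<close> satisfies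
  \<open>\<bar>e \<bullet> dir \<phi>\<bar> \<le> \<bar>\<theta> - \<phi>\<bar>\<close>, so if the
  left side exceeds \<epsilon>, then \<theta> avoids the omitted arc.\<close>

lemma sweepable_small:
  fixes \<epsilon> \<kappa> :: real
  assumes "0 < \<epsilon>" "0 < \<kappa>"
  shows "sweepable (span {e1, e2}) (dir l) \<kappa> (\<lambda>\<phi>. {e. norm e = 1 \<and> \<epsilon> < \<bar>e \<bullet> dir \<phi>\<bar>})"
proof -
  define \<epsilon>' where "\<epsilon>' = min \<epsilon> 1"
  have \<epsilon>': "0 < \<epsilon>'" "\<epsilon>' \<le> \<epsilon>" "\<epsilon>' \<le> 1" "\<epsilon>' < pi"
    using assms pi_gt3 by (auto simp: \<epsilon>'_def)
  define B where "B = 2 * DIM('a) * measure lebesgue (cball (0::'a) 7)"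
  define S where "S = sin (\<epsilon>' / 2) * sin (\<epsilon>' / 4)"
  have B: "0 \<le> B" by (simp add: B_def)
  have S: "0 < S"
    unfolding S_def using \<epsilon>' by (intro mult_pos_pos sin_gt_zero) auto
  \<comment> \<open>The three summands serve, in order, the bound \<kappa>, the inequality
    \<open>\<alpha> < \<epsilon>' / 2\<close> behind the constant \<open>S\<close>, and
    \<open>\<alpha> < 1\<close> because \<open>pi < 4\<close>.\<close>
  obtain N :: nat where N: "2 * B * pi\<^sup>2 / (\<kappa> * S) + 2 * pi / \<epsilon>' + 4 < real N"
    using reals_Archimedean2 by blast
  have "0 \<le> 2 * B * pi\<^sup>2 / (\<kappa> * S)" "0 \<le> 2 * pi / \<epsilon>'"
    using B S assms \<epsilon>' by auto
  then have N': "2 * B * pi\<^sup>2 / (\<kappa> * S) < real N" "2 * pi / \<epsilon>' < real N" "4 < real N"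
    using N by linarith+
  define \<alpha> where "\<alpha> = (pi - \<epsilon>') / N"
  have N\<alpha>: "real N * \<alpha> = pi - \<epsilon>'" using N' by (simp add: \<alpha>_def)
  have \<alpha>0: "0 < \<alpha>" using N' \<epsilon>' by (simp add: \<alpha>_def)
  have \<alpha>N: "\<alpha> \<le> pi / N"
    unfolding \<alpha>_def using \<epsilon>' by (intro divide_right_mono) auto
  have \<alpha>1: "\<alpha> < 1"
    using \<alpha>N N' pi_less_4 by (smt (verit) divide_less_eq_1)
  have "pi / N < \<epsilon>' / 2"
    using N'(2,3) \<epsilon>'(1) by (simp add: field_simps)
  then have \<alpha>2: "\<alpha> < \<epsilon>' / 2"
    using \<alpha>N by linarith
  define C where "C = B * \<alpha>\<^sup>2 * (real N + 1) * (sin ((\<epsilon>' + real N * \<alpha>) / 2) * sin ((\<epsilon>' + real N * \<alpha> - \<alpha>) / 2))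
                     / (sin (\<epsilon>' / 2) * sin ((\<epsilon>' - \<alpha>) / 2))"
  have "sweepable (span {e1, e2}) (dir l) C
      (\<lambda>\<phi>. tangents ({l - \<alpha>..<\<phi>} \<union> {\<phi> + \<epsilon>'<..<l + (\<epsilon>' + real N * \<alpha>)}))"
    using sweepable_arc[of \<alpha> \<epsilon>' N l] \<alpha>0 \<alpha>1 \<alpha>2 \<epsilon>' N\<alpha> by (simp add: C_def B_def)
  then have sw: "sweepable (span {e1, e2}) (dir l) C (\<lambda>\<phi>. tangents ({l - \<alpha>..<\<phi>} \<union> {\<phi> + \<epsilon>'<..<l + pi}))"
    using N\<alpha> by simp
  have "C \<le> (B * \<alpha>\<^sup>2 * (real N + 1) * (1 * 1)) / S"
    unfolding C_def
  proof (rule frac_le)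
    have "0 \<le> sin ((\<epsilon>' + real N * \<alpha> - \<alpha>) / 2)"
      using \<epsilon>' \<alpha>0 \<alpha>2 N\<alpha> by (intro sin_ge_zero) auto
    then have "sin ((\<epsilon>' + real N * \<alpha>) / 2) * sin ((\<epsilon>' + real N * \<alpha> - \<alpha>) / 2) \<le> 1 * 1"
      by (intro mult_mono) auto
    then show "B * \<alpha>\<^sup>2 * (real N + 1) * (sin ((\<epsilon>' + real N * \<alpha>) / 2) * sin ((\<epsilon>' + real N * \<alpha> - \<alpha>) / 2))
        \<le> B * \<alpha>\<^sup>2 * (real N + 1) * (1 * 1)"
      using B by (intro mult_left_mono) auto
    show "S \<le> sin (\<epsilon>' / 2) * sin ((\<epsilon>' - \<alpha>) / 2)"
      unfolding S_def using \<epsilon>' \<alpha>0 \<alpha>2 by (intro mult_left_mono sin_monotone_2pi_le sin_ge_zero) auto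
  qed (use B S in auto)
  also have "\<dots> \<le> (B * (pi / N)\<^sup>2 * (2 * real N)) / S"
  proof (rule divide_right_mono)
    have *: "B * \<alpha>\<^sup>2 \<le> B * (pi / N)\<^sup>2"
      using B \<alpha>0 \<alpha>N by (intro mult_left_mono power_mono) auto
    show "B * \<alpha>\<^sup>2 * (real N + 1) * (1 * 1) \<le> B * (pi / N)\<^sup>2 * (2 * real N)"
      unfolding mult_1_right by (rule mult_mono[OF *]) (use B N' in auto)
  qed (use S in simp)
  also have "B * (pi / N)\<^sup>2 * (2 * real N) = 2 * B * pi\<^sup>2 / N"
    using N'(3) by (simp add: power2_eq_square)
  also have "2 * B * pi\<^sup>2 / N / S \<le> \<kappa>"
  proof -
    have "2 * B * pi\<^sup>2 < N * (\<kappa> * S)"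
      using N'(1) S assms by (simp only: pos_divide_less_eq mult_pos_pos)
    then have "2 * B * pi\<^sup>2 \<le> \<kappa> * S * N" by (simp add: ac_simps)
    then show ?thesis
      using N'(3) S by (simp add: pos_divide_le_eq mult.assoc mult.commute[of S])
  qed
  finally have "C \<le> \<kappa>" .
  then show ?thesis
  proof (rule sweepable_mono[OF sw])
    fix \<phi>
    show "{e. norm e = 1 \<and> \<epsilon> < \<bar>e \<bullet> dir \<phi>\<bar>} \<subseteq> tangents ({l - \<alpha>..<\<phi>} \<union> {\<phi> + \<epsilon>'<..<l + pi})"
    proof clarify
      fix e :: 'a assume e: "norm e = 1" "\<epsilon> < \<bar>e \<bullet> dir \<phi>\<bar>"
      obtain \<theta> where \<theta>: "\<theta> \<in> {l..<l + pi}" "e \<bullet> dir \<theta> = 0"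
        using tangents_total[OF e(1), of l] by (auto simp: tangents_def)
      have "\<epsilon>' < \<bar>\<theta> - \<phi>\<bar>"
        using abs_inner_dir_le[OF e(1) \<theta>(2), of \<phi>] e(2) \<epsilon>' by linarith
      then show "e \<in> tangents ({l - \<alpha>..<\<phi>} \<union> {\<phi> + \<epsilon>'<..<l + pi})"
        using \<theta> e(1) \<alpha>0 \<epsilon>' unfolding tangents_def by (auto intro!: bexI[of _ \<theta>])
    qed
  qed
qed

text \<open>Only the line spanned by \<open>dir \<phi>\<close> matters, so \<phi> may be moved into
  \<open>{0..pi}\<close> at the price of a sign. The bound makes the upper limit of the angles along
  a branch a real number.\<close>

lemma dir_normalize: "\<exists>\<psi>. 0 \<le> \<psi> \<and> \<psi> \<le> pi \<and> (\<forall>e. \<bar>e \<bullet> dir \<psi>\<bar> = \<bar>e \<bullet> dir \<phi>\<bar>)"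
proof (cases "0 \<le> sin \<phi>")
  case True
  have "sin (arccos (cos \<phi>)) = sin \<phi>"
    using True by (simp add: sin_arccos_abs flip: sin_squared_eq)
  then have "dir (arccos (cos \<phi>)) = dir \<phi>"
    by (simp add: dir_def)
  then show ?thesis
    by (intro exI[of _ "arccos (cos \<phi>)"]) (auto simp: arccos_lbound arccos_ubound)
next
  case False
  have "sin (arccos (- cos \<phi>)) = - sin \<phi>"
    using False by (simp add: sin_arccos_abs flip: sin_squared_eq)
  then have "dir (arccos (- cos \<phi>)) = - dir \<phi>"
    by (simp add: dir_def)
  then show ?thesis
    by (intro exI[of _ "arccos (- cos \<phi>)"]) (auto simp: arccos_lbound arccos_ubound)
qed

text \<open>Cutting into pieces of length at most \<open>\<epsilon> / 2\<close> and refining each in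
  a tube of radius at most \<open>\<epsilon> / 4\<close> forces new segments to have length at most
  \<epsilon>. Sweeping with \<open>\<epsilon> / 2\<close> in place of \<epsilon> allows the closed
  condition \<open>\<epsilon> \<le> \<bar>e \<bullet> dir \<phi>\<bar>\<close>, which makes the
  carried part of the sphere compact.\<close>

lemma segment_refinement_open:
  fixes a b :: 'a and \<eta> \<epsilon> :: real
  assumes ab: "b - a \<in> span {e1, e2}" "dist a b \<le> 1" and \<eta>: "0 < \<eta>" and \<epsilon>: "0 < \<epsilon>"
  shows "refinable (\<lambda>\<phi>. {e. norm e = 1 \<and> \<epsilon> \<le> \<bar>e \<bullet> dir \<phi>\<bar>})
    (\<lambda>c d. closed_segment c d \<subseteq> tube a b \<eta> \<and> dist c d \<le> \<epsilon> \<and> d - c \<in> span {e1, e2}) \<epsilon> a b"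
proof -
  obtain \<theta> where \<theta>: "b - a = norm (b - a) *\<^sub>R dir \<theta>"
    using span_polar[OF ab(1)] by blast
  define l where "l = dist a b"
  have b: "b = a + l *\<^sub>R dir \<theta>" and l: "0 \<le> l" "l \<le> 1"
    using \<theta> ab by (auto simp: l_def dist_norm norm_minus_commute algebra_simps)
  let ?R = "\<lambda>\<phi>. {e. norm e = 1 \<and> \<epsilon> / 2 < \<bar>e \<bullet> dir \<phi>\<bar>}"
  let ?Q = "\<lambda>c d. closed_segment c d \<subseteq> tube a b \<eta> \<and> dist c d \<le> \<epsilon> \<and> d - c \<in> span {e1, e2}"
  have sw: "sweepable (span {e1, e2}) (dir \<theta>) (\<epsilon> / 2) ?R"
    using \<epsilon> by (intro sweepable_small) auto
  define \<delta> where "\<delta> = min \<eta> (\<epsilon> / 4)"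
  have \<delta>: "0 < \<delta>" "\<delta> \<le> \<eta>" "\<delta> \<le> \<epsilon> / 4"
    using \<eta> \<epsilon> by (auto simp: \<delta>_def)
  obtain N :: nat where N: "2 * l / \<epsilon> < real N"
    using reals_Archimedean2 by blast
  define m where "m = Suc N"
  have m: "0 < real m" "l / m \<le> \<epsilon> / 2" "l / m \<le> 1"
    using N \<epsilon> l by (auto simp: m_def field_simps)
  define f where "f j = a + (real j * l / m) *\<^sub>R dir \<theta>" for j
  have f_seg: "f j \<in> closed_segment a b" if "j \<le> m" for j
  proof -
    have "f j = (1 - real j / m) *\<^sub>R a + (real j / m) *\<^sub>R b"
      by (simp add: f_def b algebra_simps)
    then show ?thesis
      unfolding in_segment using that m by (intro exI[of _ "real j / m"]) auto
  qed
  have "refinable ?R ?Q (\<epsilon> / 2 * (l / m) + \<epsilon> / (2 * m)) (f j) (f (Suc j))" if j: "j < m" for j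
  proof -
    have f_Suc: "f (Suc j) = f j + (l / m) *\<^sub>R dir \<theta>"
      unfolding f_def using m by (simp add: field_simps flip: scaleR_left_distrib)
    have dist_f: "dist (f j) (f (Suc j)) \<le> \<epsilon> / 2"
      using m l unfolding f_Suc by (simp add: dist_norm)
    have A: "refinable ?R (\<lambda>c d. closed_segment c d \<subseteq> tube (f j) (f (Suc j)) \<delta> \<and> d - c \<in> span {e1, e2})
       (\<epsilon> / 2 * (l / m) + \<epsilon> / (2 * m)) (f j) (f (Suc j))"
      using sw[unfolded sweepable_def, rule_format, of "l / m" \<delta> "\<epsilon> / (2 * m)" "f j"] l m \<delta> \<epsilon>
      unfolding f_Suc by simp
    show ?thesis
    proof (rule refinable_mono[OF A])
      fix c d assume cd: "closed_segment c d \<subseteq> tube (f j) (f (Suc j)) \<delta> \<and> d - c \<in> span {e1, e2}"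
      have "closed_segment (f j) (f (Suc j)) \<subseteq> tube a b 0"
        using f_seg j subset_closed_segment[of "f j" "f (Suc j)" a b] by (auto simp: tube_def)
      then have "tube (f j) (f (Suc j)) \<delta> \<subseteq> tube a b (0 + \<delta>)"
        by (rule tube_trans)
      then have 1: "closed_segment c d \<subseteq> tube a b \<eta>"
        using cd tube_mono[OF \<delta>(2), of a b] by auto
      have "c \<in> tube (f j) (f (Suc j)) \<delta>" "d \<in> tube (f j) (f (Suc j)) \<delta>"
        using cd by auto
      then obtain x y where xy: "x \<in> closed_segment (f j) (f (Suc j))" "y \<in> closed_segment (f j) (f (Suc j))"
        "dist x c \<le> \<delta>" "dist y d \<le> \<delta>"
        by (auto simp: tube_def)
      have "dist c d \<le> \<epsilon>"
        using dist_closed_segment_le[OF xy(1,2)] dist_f xy(3,4) \<delta>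
          dist_triangle[of c d x] dist_triangle[of x d y] by (simp add: dist_commute)
      then show "?Q c d" using 1 cd by simp
    qed auto
  qed
  then have "refinable ?R ?Q (real m * (\<epsilon> / 2 * (l / m) + \<epsilon> / (2 * m))) (f 0) (f m)"
    by (rule refinable_chain)
  moreover have "f 0 = a" "f m = b"
    using m by (auto simp: f_def b)
  moreover have "real m * (\<epsilon> / 2 * (l / m) + \<epsilon> / (2 * m)) \<le> \<epsilon>"
    using m l \<epsilon> by (simp add: field_simps)
  ultimately show ?thesis
    using \<epsilon> by (auto elim!: refinable_mono)
qed

text \<open>What one segment carries is compact and lies in the open set \<open>U\<close>, so a
  whole tube around the segment still carries it inside \<open>U\<close>; as \<open>F\<close> is
  finite, one radius serves all segments.\<close>

lemma segment_refinement:
  fixes a b :: 'a and \<eta> \<epsilon> :: real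
  assumes ab: "b - a \<in> span {e1, e2}" "dist a b \<le> 1" and \<eta>: "0 < \<eta>" and \<epsilon>: "0 < \<epsilon>"
  obtains F \<delta> U where "finite F" "(a, b) \<in> {(c, d). \<exists>\<phi>. (c, d, \<phi>) \<in> F}\<^sup>*" "0 < \<delta>" "\<delta> \<le> \<epsilon>"
    "open U" "U \<in> lmeasurable" "measure lebesgue U \<le> \<epsilon>"
    "\<forall>(c, d, \<phi>) \<in> F. d - c \<in> span {e1, e2} \<and> dist c d \<le> \<epsilon> \<and> tube c d \<delta> \<subseteq> tube a b \<eta> \<and> 0 \<le> \<phi> \<and> \<phi> \<le> pi \<and>
       (\<forall>q\<in>tube c d \<delta>. \<forall>e. norm e = 1 \<and> \<epsilon> \<le> \<bar>e \<bullet> dir \<phi>\<bar> \<longrightarrow> q + e \<in> U)"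
proof -
  let ?E = "\<lambda>\<phi>. {e. norm e = 1 \<and> \<epsilon> \<le> \<bar>e \<bullet> dir \<phi>\<bar>}"
  obtain F U where F: "finite F" "(a, b) \<in> {(c, d). \<exists>\<phi>. (c, d, \<phi>) \<in> F}\<^sup>*" and
    U: "open U" "U \<in> lmeasurable" "measure lebesgue U \<le> \<epsilon>" and
    FU: "\<forall>(c, d, \<phi>) \<in> F. (closed_segment c d \<subseteq> tube a b (\<eta> / 2) \<and> dist c d \<le> \<epsilon> \<and> d - c \<in> span {e1, e2}) \<and>
      (\<forall>q\<in>closed_segment c d. \<forall>e\<in>?E \<phi>. q + e \<in> U)"
    using segment_refinement_open[OF ab, of "\<eta> / 2" \<epsilon>] \<eta> \<epsilon> unfolding refinable_def by auto
  have "\<exists>\<delta>>0. \<forall>q\<in>tube c d \<delta>. \<forall>e\<in>?E \<phi>. q + e \<in> U" if "(c, d, \<phi>) \<in> F" for c d \<phi>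
  proof -
    have "?E \<phi> = sphere 0 1 \<inter> {e. \<epsilon> \<le> \<bar>e \<bullet> dir \<phi>\<bar>}" by auto
    moreover have "closed {e. \<epsilon> \<le> \<bar>e \<bullet> dir \<phi>\<bar>}"
      by (intro closed_Collect_le continuous_intros)
    ultimately have "compact (?E \<phi>)" by (simp add: compact_Int_closed)
    then have K: "compact {q + e |q e. q \<in> closed_segment c d \<and> e \<in> ?E \<phi>}"
      by (intro compact_sums) auto
    have "\<forall>q\<in>closed_segment c d. \<forall>e\<in>?E \<phi>. q + e \<in> U"
      using bspec[OF FU that] by simp
    then have "{q + e |q e. q \<in> closed_segment c d \<and> e \<in> ?E \<phi>} \<subseteq> U" by blast
    from compact_subset_open_imp_cball_epsilon_subset[OF K U(1) this]
    obtain \<delta> where \<delta>: "0 < \<delta>" "(\<Union>x\<in>{q + e |q e. q \<in> closed_segment c d \<and> e \<in> ?E \<phi>}. cball x \<delta>) \<subseteq> U" .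
    have "q + e \<in> U" if q: "q \<in> tube c d \<delta>" and e: "e \<in> ?E \<phi>" for q e
    proof -
      obtain p where p: "p \<in> closed_segment c d" "dist p q \<le> \<delta>"
        using q by (auto simp: tube_def)
      have "q + e \<in> cball (p + e) \<delta>" using p by (simp add: dist_norm)
      then show ?thesis using \<delta>(2) p(1) e by blast
    qed
    then show ?thesis using \<delta>(1) by blast
  qed
  then have "\<forall>x\<in>F. \<exists>\<delta>>0. \<forall>q\<in>tube (fst x) (fst (snd x)) \<delta>. \<forall>e\<in>?E (snd (snd x)). q + e \<in> U"
    by auto
  from bchoice[OF this] obtain g where
    g: "\<forall>x\<in>F. 0 < g x \<and> (\<forall>q\<in>tube (fst x) (fst (snd x)) (g x). \<forall>e\<in>?E (snd (snd x)). q + e \<in> U)" ..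
  \<comment> \<open>The new segments were placed in the tube of radius \<open>\<eta> / 2\<close>; a
    radius of at most \<open>\<eta> / 2\<close> around them keeps the tubes nested.\<close>
  define \<delta> where "\<delta> = Min (insert (\<eta> / 2) (insert \<epsilon> (g ` F)))"
  have \<delta>_le: "\<delta> \<le> x" if "x \<in> insert (\<eta> / 2) (insert \<epsilon> (g ` F))" for x
    unfolding \<delta>_def using F(1) that by (intro Min_le) auto
  have "0 < \<delta>"
    unfolding \<delta>_def using F(1) g \<eta> \<epsilon> by (subst Min_gr_iff) auto
  then have \<delta>: "0 < \<delta>" "\<delta> \<le> \<eta> / 2" "\<delta> \<le> \<epsilon>" "\<And>x. x \<in> F \<Longrightarrow> \<delta> \<le> g x"
    using \<delta>_le[of "\<eta> / 2"] \<delta>_le[of \<epsilon>] \<delta>_le by auto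
  have "\<forall>\<phi>. \<exists>\<psi>. 0 \<le> \<psi> \<and> \<psi> \<le> pi \<and> (\<forall>e. \<bar>e \<bullet> dir \<psi>\<bar> = \<bar>e \<bullet> dir \<phi>\<bar>)"
    using dir_normalize by blast
  from choice[OF this] obtain nrm where
    nrm: "\<forall>\<phi>. 0 \<le> nrm \<phi> \<and> nrm \<phi> \<le> pi \<and> (\<forall>e. \<bar>e \<bullet> dir (nrm \<phi>)\<bar> = \<bar>e \<bullet> dir \<phi>\<bar>)" ..
  define G where "G = (\<lambda>(c, d, \<phi>). (c, d, nrm \<phi>)) ` F"
  have GF: "\<exists>\<psi>. (c, d, \<psi>) \<in> F \<and> \<phi> = nrm \<psi>" if "(c, d, \<phi>) \<in> G" for c d \<phi>
    using that by (auto simp: G_def)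
  show ?thesis
  proof (rule that[of G \<delta> U])
    show "finite G" using F by (simp add: G_def)
    have "{(c, d). \<exists>\<phi>. (c, d, \<phi>) \<in> F} \<subseteq> {(c, d). \<exists>\<phi>. (c, d, \<phi>) \<in> G}"
      unfolding G_def by force
    then show "(a, b) \<in> {(c, d). \<exists>\<phi>. (c, d, \<phi>) \<in> G}\<^sup>*"
      using F(2) rtrancl_mono by blast
  next
    show "\<forall>(c, d, \<phi>) \<in> G. d - c \<in> span {e1, e2} \<and> dist c d \<le> \<epsilon> \<and> tube c d \<delta> \<subseteq> tube a b \<eta> \<and> 0 \<le> \<phi> \<and> \<phi> \<le> pi \<and>
       (\<forall>q\<in>tube c d \<delta>. \<forall>e. norm e = 1 \<and> \<epsilon> \<le> \<bar>e \<bullet> dir \<phi>\<bar> \<longrightarrow> q + e \<in> U)"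
    proof (clarify, intro conjI ballI allI impI)
      fix c d \<phi> assume "(c, d, \<phi>) \<in> G"
      then obtain \<psi> where \<psi>: "(c, d, \<psi>) \<in> F" "\<phi> = nrm \<psi>" using GF by blast
      then have cd: "closed_segment c d \<subseteq> tube a b (\<eta> / 2)" "dist c d \<le> \<epsilon>" "d - c \<in> span {e1, e2}"
        using FU by auto
      have "tube c d \<delta> \<subseteq> tube a b (\<eta> / 2 + \<delta>)"
        using cd(1) by (rule tube_trans)
      also have "\<dots> \<subseteq> tube a b \<eta>" using \<delta> by (intro tube_mono) auto
      finally show "tube c d \<delta> \<subseteq> tube a b \<eta>" .
      show "d - c \<in> span {e1, e2}" "dist c d \<le> \<epsilon>" "0 \<le> \<phi>" "\<phi> \<le> pi"
        using cd nrm \<psi> by auto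
      fix q e assume q: "q \<in> tube c d \<delta>" and e: "norm e = 1 \<and> \<epsilon> \<le> \<bar>e \<bullet> dir \<phi>\<bar>"
      have "q \<in> tube c d (g (c, d, \<psi>))"
        using q tube_mono[OF \<delta>(4)[OF \<psi>(1)], of c d] by auto
      then show "q + e \<in> U"
        using bspec[OF g \<psi>(1)] e nrm \<psi>(2) by simp
    qed
  qed (use \<delta> U in auto)
qed

end

section \<open>The refinement tree\<close>

lemma closed_tube: "closed (tube a b \<delta>)"
proof -
  have "tube a b \<delta> = {x + z |x z. x \<in> closed_segment a b \<and> z \<in> cball 0 \<delta>}"
  proof safe
    fix q assume "q \<in> tube a b \<delta>"
    then obtain x where "x \<in> closed_segment a b" "dist x q \<le> \<delta>"
      by (auto simp: tube_def)
    then show "\<exists>x z. q = x + z \<and> x \<in> closed_segment a b \<and> z \<in> cball 0 \<delta>"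
      by (intro exI[of _ x] exI[of _ "q - x"]) (simp add: dist_norm norm_minus_commute)
  qed (force simp: tube_def dist_norm)
  moreover have "compact {x + z |x z. x \<in> closed_segment a b \<and> z \<in> cball 0 \<delta>}"
    by (intro compact_sums) auto
  ultimately show ?thesis by (simp add: compact_imp_closed)
qed

text \<open>A discrete intermediate value theorem: with \<open>P\<close> the closed unit ball around
  \<open>y\<close>, a polygonal path that leaves the ball has a segment whose end points it
  separates.\<close>

lemma rtrancl_exit:
  assumes "(a, b) \<in> r\<^sup>*" "P a" "\<not> P b"
  obtains c d where "(c, d) \<in> r" "P c" "\<not> P d"
proof -
  have "\<exists>c d. (c, d) \<in> r \<and> P c \<and> \<not> P d"
    using assms by (induction rule: rtrancl_induct) auto
  then show ?thesis using that by blast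
qed

text \<open>Serves measurable selection: the set of eligible nodes takes finitely many values, so
  any choice made from that set alone is again a simple function of \<open>y\<close>.\<close>

lemma simple_function_filter:
  assumes "finite L" "\<And>s. s \<in> L \<Longrightarrow> {y \<in> space M. P s y} \<in> sets M"
  shows "simple_function M (\<lambda>y. {s \<in> L. P s y})"
  unfolding simple_function_def
proof (intro conjI ballI)
  have "(\<lambda>y. {s \<in> L. P s y}) ` space M \<subseteq> Pow L" by auto
  then show "finite ((\<lambda>y. {s \<in> L. P s y}) ` space M)"
    using assms(1) by (rule finite_subset[OF _ iffD2[OF finite_Pow_iff]])
next
  fix T assume "T \<in> (\<lambda>y. {s \<in> L. P s y}) ` space M"
  then have "T \<subseteq> L" by auto
  then have "(\<lambda>y. {s \<in> L. P s y}) -` {T} \<inter> space M = {y \<in> space M. \<forall>s\<in>L. s \<in> T \<longleftrightarrow> P s y}"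
    by auto
  also have "\<dots> \<in> sets M"
  proof (rule sets.sets_Collect_finite_All[OF _ assms(1)])
    fix s assume "s \<in> L"
    show "{y \<in> space M. (s \<in> T) = P s y} \<in> sets M"
      using assms(2)[OF \<open>s \<in> L\<close>] by (cases "s \<in> T") (auto intro: sets.sets_Collect_neg)
  qed
  finally show "(\<lambda>y. {s \<in> L. P s y}) -` {T} \<inter> space M \<in> sets M" .
qed

text \<open>A node \<open>(c, d, \<delta>, \<phi>)\<close> consists of the segment from \<open>c\<close> to \<open>d\<close>, the radius \<open>\<delta>\<close> of the tube
  that contains all its descendants, and the angle \<open>\<phi>\<close> of the normal of the removed great subsphere.\<close>

type_synonym 'b node = "'b \<times> 'b \<times> real \<times> real"

definition node_tube :: "'a::euclidean_space node \<Rightarrow> 'a set" where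
  "node_tube s = (case s of (c, d, \<delta>, \<phi>) \<Rightarrow> tube c d \<delta>)"

definition node_angle :: "'a node \<Rightarrow> real" where
  "node_angle s = (case s of (c, d, \<delta>, \<phi>) \<Rightarrow> \<phi>)"

text \<open>The second condition negates the first at the other end point, so crossing passes to
  some segment of a path with its orientation kept. In the limit the two inequalities pinch the
  distance to exactly 1.\<close>

definition crosses :: "'a::euclidean_space \<Rightarrow> 'a node \<Rightarrow> bool" where
  "crosses y s \<longleftrightarrow> dist (fst s) y \<le> 1 \<and> 1 < dist (fst (snd s)) y"

context orthonormal_pair begin

definition node_size :: "real \<Rightarrow> 'a node \<Rightarrow> bool" where
  "node_size \<epsilon> s \<longleftrightarrow> (case s of (c, d, \<delta>, \<phi>) \<Rightarrow>
     d - c \<in> span {e1, e2} \<and> dist c d \<le> \<epsilon> \<and> 0 < \<delta> \<and> \<delta> \<le> \<epsilon> \<and> 0 \<le> \<phi> \<and> \<phi> \<le> pi)"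

definition children :: "real \<Rightarrow> 'a node \<Rightarrow> 'a node set \<Rightarrow> 'a set \<Rightarrow> bool" where
  "children \<epsilon> s T U \<longleftrightarrow> finite T \<and> U \<in> lmeasurable \<and> measure lebesgue U \<le> \<epsilon> \<and>
     (\<forall>y. crosses y s \<longrightarrow> (\<exists>t\<in>T. crosses y t)) \<and>
     (\<forall>t\<in>T. node_size \<epsilon> t \<and> node_tube t \<subseteq> node_tube s \<and>
        (\<forall>q\<in>node_tube t. \<forall>e. norm e = 1 \<and> \<epsilon> \<le> \<bar>e \<bullet> dir (node_angle t)\<bar> \<longrightarrow> q + e \<in> U))"

lemma children_exist:
  assumes "node_size 1 s" "0 < \<epsilon>"
  shows "\<exists>T U. children \<epsilon> s T U"
proof -
  obtain a b \<eta> \<phi>0 where s: "s = (a, b, \<eta>, \<phi>0)" by (cases s)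
  then have ab: "b - a \<in> span {e1, e2}" "dist a b \<le> 1" "0 < \<eta>"
    using assms by (auto simp: node_size_def)
  obtain F \<delta> U where
    F: "finite F" "(a, b) \<in> {(c, d). \<exists>\<phi>. (c, d, \<phi>) \<in> F}\<^sup>*" and \<delta>: "0 < \<delta>" "\<delta> \<le> \<epsilon>" and
    U: "open U" "U \<in> lmeasurable" "measure lebesgue U \<le> \<epsilon>" and
    FU: "\<forall>(c, d, \<phi>) \<in> F. d - c \<in> span {e1, e2} \<and> dist c d \<le> \<epsilon> \<and> tube c d \<delta> \<subseteq> tube a b \<eta> \<and> 0 \<le> \<phi> \<and> \<phi> \<le> pi \<and>
       (\<forall>q\<in>tube c d \<delta>. \<forall>e. norm e = 1 \<and> \<epsilon> \<le> \<bar>e \<bullet> dir \<phi>\<bar> \<longrightarrow> q + e \<in> U)"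
    by (rule segment_refinement[OF ab assms(2)])
  define T where "T = (\<lambda>(c, d, \<phi>). (c, d, \<delta>, \<phi>)) ` F"
  have "\<exists>t\<in>T. crosses y t" if y: "crosses y s" for y
  proof -
    obtain c d where "(c, d) \<in> {(c, d). \<exists>\<phi>. (c, d, \<phi>) \<in> F}" "dist c y \<le> 1" "\<not> dist d y \<le> 1"
      using rtrancl_exit[OF F(2), of "\<lambda>x. dist x y \<le> 1"] y by (auto simp: crosses_def s)
    then obtain \<phi> where "(c, d, \<phi>) \<in> F" "crosses y (c, d, \<delta>, \<phi>)"
      by (auto simp: crosses_def)
    then show ?thesis unfolding T_def by force
  qed
  moreover have "node_size \<epsilon> t \<and> node_tube t \<subseteq> node_tube s \<and>
        (\<forall>q\<in>node_tube t. \<forall>e. norm e = 1 \<and> \<epsilon> \<le> \<bar>e \<bullet> dir (node_angle t)\<bar> \<longrightarrow> q + e \<in> U)"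
    if t: "t \<in> T" for t
  proof -
    obtain c d \<phi> where t: "t = (c, d, \<delta>, \<phi>)" "(c, d, \<phi>) \<in> F"
      using t by (auto simp: T_def)
    show ?thesis
      using bspec[OF FU t(2)] \<delta> unfolding t(1) s
      by (simp add: node_size_def node_tube_def node_angle_def)
  qed
  ultimately have "children \<epsilon> s T U"
    unfolding children_def using F(1) U by (auto simp: T_def)
  then show ?thesis by blast
qed

lemma refinement_tree:
  assumes s0: "node_size 1 s0"
  obtains L :: "nat \<Rightarrow> 'a node set" and ch :: "nat \<Rightarrow> 'a node \<Rightarrow> 'a node set" and U :: "nat \<Rightarrow> 'a set"
  where "L 0 = {s0}" "\<forall>k. finite (L k)"
    "\<forall>k. U k \<in> lmeasurable \<and> measure lebesgue (U k) \<le> (1/2) ^ k"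
    "\<forall>k. \<forall>s\<in>L k. ch k s \<subseteq> L (Suc k) \<and> (\<forall>y. crosses y s \<longrightarrow> (\<exists>t\<in>ch k s. crosses y t))"
    "\<forall>k. \<forall>s\<in>L k. \<forall>t\<in>ch k s. node_size ((1/2) ^ k) t \<and> node_tube t \<subseteq> node_tube s \<and>
       (\<forall>q\<in>node_tube t. \<forall>e. norm e = 1 \<and> (1/2) ^ k \<le> \<bar>e \<bullet> dir (node_angle t)\<bar> \<longrightarrow> q + e \<in> U k)"
proof -
  have "\<forall>x. \<exists>TU. node_size 1 (snd x) \<and> 0 < fst x \<longrightarrow> children (fst x) (snd x) (fst TU) (snd TU)"
  proof
    fix x
    show "\<exists>TU. node_size 1 (snd x) \<and> 0 < fst x \<longrightarrow> children (fst x) (snd x) (fst TU) (snd TU)"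
    proof (cases "node_size 1 (snd x) \<and> 0 < fst x")
      case True
      then obtain T U where "children (fst x) (snd x) T U"
        using children_exist by blast
      then show ?thesis by (intro exI[of _ "(T, U)"]) simp
    qed blast
  qed
  from choice[OF this] obtain TU where
    TU: "\<forall>x. node_size 1 (snd x) \<and> 0 < fst x \<longrightarrow> children (fst x) (snd x) (fst (TU x)) (snd (TU x))" ..
  \<comment> \<open>All nodes of a level are refined with the same accuracy, which depends on their
    number: together they contribute at most \<open>(1/2) ^ k\<close> to \<open>U k\<close>. The
    added 1 keeps the denominator positive.\<close>
  define eps where "eps k A = (1/2::real) ^ k / (1 + card A)" for k and A :: "'a node set"
  define L where "L = rec_nat {s0} (\<lambda>k A. \<Union>s\<in>A. fst (TU (eps k A, s)))"
  define ch where "ch k s = fst (TU (eps k (L k), s))" for k s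
  define U where "U k = (\<Union>s\<in>L k. snd (TU (eps k (L k), s)))" for k
  have L0: "L 0 = {s0}" and LS: "L (Suc k) = (\<Union>s\<in>L k. ch k s)" for k
    by (auto simp: L_def ch_def)
  have eps: "0 < eps k A" "eps k A \<le> (1/2) ^ k" "card A * eps k A \<le> (1/2) ^ k" for k A
  proof -
    have "0 < p / (1 + n) \<and> p / (1 + n) \<le> p \<and> n * (p / (1 + n)) \<le> p" if "0 < p" "0 \<le> n" for p n :: real
      using that by (simp add: field_simps)
    from this[of "(1/2) ^ k" "card A"] show "0 < eps k A" "eps k A \<le> (1/2) ^ k" "card A * eps k A \<le> (1/2) ^ k"
      by (simp_all add: eps_def)
  qed
  have eps1: "eps k A \<le> 1" for k A
    using eps(2)[of k A] power_le_one[of "1/2::real" k] by simp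
  have size_mono: "node_size \<epsilon>' t" if "node_size \<epsilon> t" "\<epsilon> \<le> \<epsilon>'" for \<epsilon> \<epsilon>' t
    using that by (auto simp: node_size_def)
  have L: "finite (L k) \<and> (\<forall>s\<in>L k. node_size 1 s)" for k
  proof (induction k)
    case 0
    show ?case using s0 by (simp add: L0)
  next
    case (Suc k)
    have "children (eps k (L k)) s (ch k s) (snd (TU (eps k (L k), s)))" if "s \<in> L k" for s
      using TU[rule_format, of "(eps k (L k), s)"] Suc that eps(1) by (simp add: ch_def)
    then have "finite (ch k s)" "\<forall>t\<in>ch k s. node_size 1 t" if "s \<in> L k" for s
      using that size_mono[OF _ eps1] unfolding children_def by blast+
    then show ?case using Suc by (auto simp: LS)
  qed
  have C: "children (eps k (L k)) s (ch k s) (snd (TU (eps k (L k), s)))" if "s \<in> L k" for s k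
    using TU[rule_format, of "(eps k (L k), s)"] L that eps(1) by (simp add: ch_def)
  show ?thesis
  proof (rule that[of L U ch])
    show "L 0 = {s0}" by (rule L0)
    show "\<forall>k. finite (L k)" using L by blast
    have "U k \<in> lmeasurable" for k
      unfolding U_def using L C by (intro fmeasurable.finite_UN) (auto simp: children_def)
    moreover have "measure lebesgue (U k) \<le> (1/2) ^ k" for k
    proof -
      have "measure lebesgue (U k) \<le> (\<Sum>s\<in>L k. measure lebesgue (snd (TU (eps k (L k), s))))"
        unfolding U_def using L C by (intro measure_UNION_le) (auto simp: children_def fmeasurableD)
      also have "\<dots> \<le> (\<Sum>s\<in>L k. eps k (L k))"
        using C by (intro sum_mono) (auto simp: children_def)
      finally show ?thesis using eps(3)[of "L k" k] by simp
    qed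
    ultimately show "\<forall>k. U k \<in> lmeasurable \<and> measure lebesgue (U k) \<le> (1/2) ^ k" by blast
    show "\<forall>k. \<forall>s\<in>L k. ch k s \<subseteq> L (Suc k) \<and> (\<forall>y. crosses y s \<longrightarrow> (\<exists>t\<in>ch k s. crosses y t))"
      using C by (auto simp: LS children_def)
    show "\<forall>k. \<forall>s\<in>L k. \<forall>t\<in>ch k s. node_size ((1/2) ^ k) t \<and> node_tube t \<subseteq> node_tube s \<and>
       (\<forall>q\<in>node_tube t. \<forall>e. norm e = 1 \<and> (1/2) ^ k \<le> \<bar>e \<bullet> dir (node_angle t)\<bar> \<longrightarrow> q + e \<in> U k)"
    proof (intro allI ballI conjI impI)
      fix k s t assume st: "s \<in> L k" "t \<in> ch k s"
      have t: "node_size (eps k (L k)) t" "node_tube t \<subseteq> node_tube s"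
        "\<And>q e. q \<in> node_tube t \<Longrightarrow> norm e = 1 \<Longrightarrow> eps k (L k) \<le> \<bar>e \<bullet> dir (node_angle t)\<bar> \<Longrightarrow> q + e \<in> snd (TU (eps k (L k), s))"
        using C[OF st(1)] st(2) unfolding children_def by blast+
      show "node_size ((1/2) ^ k) t" "node_tube t \<subseteq> node_tube s"
        using t(2) size_mono[OF t(1) eps(2)] by auto
      fix q e assume "q \<in> node_tube t" "norm e = 1 \<and> (1/2) ^ k \<le> \<bar>e \<bullet> dir (node_angle t)\<bar>"
      then have "q + e \<in> snd (TU (eps k (L k), s))"
        using t(3) eps(2)[of k "L k"] by (meson order_trans)
      then show "q + e \<in> U k" unfolding U_def using st(1) by blast
    qed
  qed
qed

section \<open>Limits of positions and angles along a branch\<close>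

lemma convergent_geometric_steps:
  fixes f :: "nat \<Rightarrow> 'a"
  assumes "\<And>k. dist (f k) (f (Suc k)) \<le> C * (1/2) ^ k"
  shows "convergent f"
proof -
  have "summable (\<lambda>k. C * (1/2::real) ^ k)"
    by (intro summable_mult summable_geometric) auto
  then have "summable (\<lambda>k. f (Suc k) - f k)"
    by (rule summable_comparison_test'[where N = 0]) (use assms in \<open>auto simp: dist_norm norm_minus_commute\<close>)
  then have "convergent (\<lambda>n. \<Sum>k<n. f (Suc k) - f k)"
    by (simp add: summable_iff_convergent)
  then have "convergent (\<lambda>n. f n - f 0)"
    by (simp add: sum_lessThan_telescope)
  then show ?thesis
    by (simp add: convergent_diff_const_right_iff)
qed

text \<open>The upper limit is attained along a subsequence, and \<open>dir\<close> is continuous,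
  so smallness of the inner products passes to it. The bounds on \<psi> exclude infinite values, so
  \<open>real_of_ereal\<close> loses nothing.\<close>

lemma inner_dir_limsup_eq_0:
  fixes \<psi> :: "nat \<Rightarrow> real" and e :: 'a
  assumes \<psi>: "\<And>k. 0 \<le> \<psi> k" "\<And>k. \<psi> k \<le> pi"
    and small: "\<And>k. k > n \<Longrightarrow> \<bar>e \<bullet> dir (\<psi> k)\<bar> \<le> \<delta> k" and "\<delta> \<longlonglongrightarrow> 0"
  shows "e \<bullet> dir (real_of_ereal (limsup (\<lambda>k. ereal (\<psi> k)))) = 0"
proof -
  let ?u = "\<lambda>k. ereal (\<psi> k)"
  obtain r where r: "strict_mono r" "(?u \<circ> r) \<longlonglongrightarrow> limsup ?u"
    using limsup_subseq_lim[of ?u] by blast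
  have "0 \<le> limsup ?u"
    using r(2) by (rule LIMSEQ_le_const) (use \<psi> in auto)
  moreover have "limsup ?u \<le> ereal pi"
    using r(2) by (rule LIMSEQ_le_const2) (use \<psi> in auto)
  ultimately obtain x where x: "limsup ?u = ereal x"
    by (cases "limsup ?u") auto
  have "(\<lambda>k. \<psi> (r k)) \<longlonglongrightarrow> x"
    using r(2) unfolding x comp_def by simp
  then have "(\<lambda>k. \<bar>e \<bullet> dir (\<psi> (r k))\<bar>) \<longlonglongrightarrow> \<bar>e \<bullet> dir x\<bar>"
    unfolding dir_def by (intro tendsto_intros)
  moreover have "(\<lambda>k. \<bar>e \<bullet> dir (\<psi> (r k))\<bar>) \<longlonglongrightarrow> 0"
  proof (rule tendsto_sandwich[where f = "\<lambda>_. 0" and h = "\<lambda>k. \<delta> (r k)"])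
    show "\<forall>\<^sub>F k in sequentially. \<bar>e \<bullet> dir (\<psi> (r k))\<bar> \<le> \<delta> (r k)"
      using eventually_gt_at_top[of n]
    proof eventually_elim
      case (elim k)
      then have "n < r k" using seq_suble[OF r(1), of k] by simp
      then show ?case by (rule small)
    qed
    show "(\<lambda>k. \<delta> (r k)) \<longlonglongrightarrow> 0"
      using LIMSEQ_subseq_LIMSEQ[OF \<open>\<delta> \<longlonglongrightarrow> 0\<close> r(1)] by (simp add: comp_def)
  qed auto
  ultimately have "\<bar>e \<bullet> dir x\<bar> = 0"
    by (rule LIMSEQ_unique)
  then show ?thesis by (simp add: x)
qed

end

section \<open>Passage to the limit\<close>

context orthonormal_pair begin

text \<open>The root is the segment from 0 to \<open>e1\<close>. A point \<open>y\<close> of the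
  given ball has distance at most 3/4 from 0 and at least 5/4 from \<open>e1\<close>, hence crosses
  it.\<close>

lemma nikodym_spheres_ball:
  obtains A :: "'a set" and p :: "'a \<Rightarrow> 'a" and \<psi> :: "'a \<Rightarrow> real"
  where "A \<in> null_sets lebesgue" "p \<in> borel_measurable borel" "\<psi> \<in> borel_measurable borel"
    "\<forall>y. dist (- (1/2) *\<^sub>R e1) y \<le> 1/4 \<longrightarrow>
       dist (p y) y = 1 \<and> (\<forall>e. norm e = 1 \<and> e \<bullet> dir (\<psi> y) \<noteq> 0 \<longrightarrow> p y + e \<in> A)"
proof -
  define s0 :: "'a node" where "s0 = (0, e1, 1, 0)"
  have "node_size 1 s0"
    using e1 by (simp add: node_size_def s0_def span_base)
  then obtain L ch U where L0: "L 0 = {s0}" and fin: "\<forall>k. finite (L k)" and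
    U: "\<forall>k. U k \<in> lmeasurable \<and> measure lebesgue (U k) \<le> (1/2) ^ k" and
    ch_L: "\<forall>k. \<forall>s\<in>L k. ch k s \<subseteq> L (Suc k) \<and> (\<forall>y. crosses y s \<longrightarrow> (\<exists>t\<in>ch k s. crosses y t))" and
    ch: "\<forall>k. \<forall>s\<in>L k. \<forall>t\<in>ch k s. node_size ((1/2) ^ k) t \<and> node_tube t \<subseteq> node_tube s \<and>
       (\<forall>q\<in>node_tube t. \<forall>e. norm e = 1 \<and> (1/2) ^ k \<le> \<bar>e \<bullet> dir (node_angle t)\<bar> \<longrightarrow> q + e \<in> U k)"
    by (rule refinement_tree)
  have ch_size: "node_size ((1/2) ^ k) t \<and> node_tube t \<subseteq> node_tube s" if "s \<in> L k" "t \<in> ch k s" for k s t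
    using ch that by blast
  have ch_U: "q + e \<in> U k" if "s \<in> L k" "t \<in> ch k s" "q \<in> node_tube t" "norm e = 1"
    "(1/2) ^ k \<le> \<bar>e \<bullet> dir (node_angle t)\<bar>" for k s t q e
    using ch that by blast
  define T where "T k y = {s \<in> L k. crosses y s}" for k and y :: 'a
  \<comment> \<open>The chosen child depends on \<open>y\<close> only through the previous node and
    the finite set \<open>T (Suc k) y\<close>, so measurability survives the use of
    \<open>SOME\<close>.\<close>
  define G where "G y = rec_nat s0 (\<lambda>k s. SOME t. t \<in> ch k s \<inter> T (Suc k) y)" for y
  have G0: "G y 0 = s0" and GS: "G y (Suc k) = (SOME t. t \<in> ch k (G y k) \<inter> T (Suc k) y)" for y k
    by (auto simp: G_def)
  have T_simple: "simple_function borel (T k)" for k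
    unfolding T_def
  proof (rule simple_function_filter[OF spec[OF fin]])
    fix s :: "'a node"
    show "{y \<in> space borel. crosses y s} \<in> sets borel"
      unfolding crosses_def by measurable
  qed
  have G_simple: "simple_function borel (\<lambda>y. G y k)" for k
  proof (induction k)
    case 0
    show ?case by (simp add: G0)
  next
    case (Suc k)
    then show ?case
      unfolding GS by (rule simple_function_compose2[OF _ T_simple])
  qed
  define p where "p y = lim (\<lambda>k. fst (G y k))" for y
  define \<psi> where "\<psi> y = real_of_ereal (limsup (\<lambda>k. ereal (node_angle (G y k))))" for y
  have [measurable]: "(\<lambda>y. fst (G y k)) \<in> borel_measurable borel"
    "(\<lambda>y. node_angle (G y k)) \<in> borel_measurable borel" for k
    using borel_measurable_simple_function[OF simple_function_compose1[OF G_simple, of fst]]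
      borel_measurable_simple_function[OF simple_function_compose1[OF G_simple, of node_angle]] by auto
  have p_borel: "p \<in> borel_measurable borel"
    unfolding p_def by measurable
  have \<psi>_borel: "\<psi> \<in> borel_measurable borel"
    unfolding \<psi>_def by measurable
  \<comment> \<open>The null set consists of the points in infinitely many \<open>U k\<close>;
    summability allows Borel-Cantelli.\<close>
  have "summable (\<lambda>k. measure lebesgue (U k))"
    by (rule summable_comparison_test'[where N = 0 and g = "\<lambda>k. (1/2) ^ k"])
      (use U in \<open>auto intro: summable_geometric\<close>)
  moreover have "U k \<in> sets lebesgue" "emeasure lebesgue (U k) < \<infinity>" for k
    using U unfolding fmeasurable_def by blast+
  ultimately have A_null: "limsup U \<in> null_sets lebesgue"
    by (intro borel_cantelli_limsup1)
  have main: "dist (p y) y = 1 \<and> (\<forall>e. norm e = 1 \<and> e \<bullet> dir (\<psi> y) \<noteq> 0 \<longrightarrow> p y + e \<in> limsup U)"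
    if y: "dist (- (1/2) *\<^sub>R e1) y \<le> 1/4" for y
  proof -
    have "crosses y s0"
    proof -
      have "dist 0 y \<le> dist 0 (- (1/2) *\<^sub>R e1) + dist (- (1/2) *\<^sub>R e1) y"
        by (rule dist_triangle)
      moreover have "dist e1 (- (1/2) *\<^sub>R e1) \<le> dist e1 y + dist (- (1/2) *\<^sub>R e1) y"
        by (rule dist_triangle2)
      moreover have "dist e1 (- (1/2) *\<^sub>R e1) = 3/2"
      proof -
        have "e1 - (- (1/2) *\<^sub>R e1) = (1 + 1/2) *\<^sub>R e1"
          by (simp only: scaleR_add_left scaleR_one scaleR_minus_left) simp
        then show ?thesis using e1 by (simp add: dist_norm)
      qed
      ultimately show ?thesis
        using y e1 by (simp add: crosses_def s0_def)
    qed
    then have G_inv: "G y k \<in> L k \<and> crosses y (G y k)" for k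
    proof (induction k)
      case 0
      then show ?case by (simp add: G0 L0)
    next
      case (Suc k)
      then obtain t where "t \<in> ch k (G y k)" "crosses y t"
        using ch_L by blast
      then have "\<exists>t. t \<in> ch k (G y k) \<inter> T (Suc k) y"
        using Suc ch_L unfolding T_def by blast
      then have "G y (Suc k) \<in> ch k (G y k) \<inter> T (Suc k) y"
        unfolding GS by (rule someI_ex)
      then show ?case by (auto simp: T_def)
    qed
    have G_ch: "G y (Suc k) \<in> ch k (G y k)" for k
    proof -
      have "\<exists>t. t \<in> ch k (G y k) \<inter> T (Suc k) y"
        using G_inv[of k] ch_L unfolding T_def by blast
      from someI_ex[OF this] show ?thesis unfolding GS by blast
    qed
    define a where "a k = fst (G y k)" for k
    define b where "b k = fst (snd (G y k))" for k
    define \<delta> where "\<delta> k = fst (snd (snd (G y k)))" for k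
    have G_eq: "G y k = (a k, b k, \<delta> k, node_angle (G y k))" for k
      by (cases "G y k") (simp add: a_def b_def \<delta>_def node_angle_def)
    \<comment> \<open>A node of level \<open>Suc j\<close> was made with accuracy
      \<open>(1/2) ^ j\<close>, twice the power belonging to its own level; with the factor 2 the
      bound also holds at the root.\<close>
    have size: "node_size (2 * (1/2) ^ k) (G y k)" for k
    proof (cases k)
      case 0
      then show ?thesis using e1 by (simp add: G0 s0_def node_size_def span_base)
    next
      case (Suc j)
      then show ?thesis using ch_size[OF conjunct1[OF G_inv] G_ch, of j] by simp
    qed
    have ab: "dist (a k) (b k) \<le> 2 * (1/2) ^ k" "0 < \<delta> k" "\<delta> k \<le> 2 * (1/2) ^ k"
      "0 \<le> node_angle (G y k)" "node_angle (G y k) \<le> pi" for k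
      using size[of k] G_eq[of k] by (auto simp: node_size_def split: prod.splits)
    have tube_eq: "node_tube (G y k) = tube (a k) (b k) (\<delta> k)" for k
      using G_eq[of k] by (auto simp: node_tube_def split: prod.splits)
    have nested: "node_tube (G y m) \<subseteq> node_tube (G y k)" if "k \<le> m" for k m
      using that
    proof (induction rule: dec_induct)
      case (step j)
      then show ?case using ch_size[OF conjunct1[OF G_inv] G_ch, of j] by blast
    qed simp
    have a_tube: "a m \<in> node_tube (G y k)" if "k \<le> m" for k m
      using nested[OF that] closed_segment_subset_tube[of "\<delta> m" "a m" "b m"] ab(2)[of m] unfolding tube_eq by auto
    have "dist (a k) (a (Suc k)) \<le> 4 * (1/2) ^ k" for k
    proof -
      obtain x where x: "x \<in> closed_segment (a k) (b k)" "dist x (a (Suc k)) \<le> \<delta> k"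
        using a_tube[of k "Suc k"] unfolding tube_eq tube_def by auto
      have "dist (a k) x \<le> dist (a k) (b k)"
        by (rule dist_closed_segment_le) (use x in auto)
      then show ?thesis
        using x(2) ab(1,3)[of k] dist_triangle[of "a k" "a (Suc k)" x] by simp
    qed
    then have "convergent a"
      by (rule convergent_geometric_steps)
    then have a_lim: "a \<longlonglongrightarrow> p y"
      unfolding p_def a_def by (simp add: convergent_LIMSEQ_iff)
    have z: "(\<lambda>k. 2 * (1/2::real) ^ k) \<longlonglongrightarrow> 0"
      by (intro tendsto_mult_right_zero LIMSEQ_power_zero) simp
    have "(\<lambda>k. dist (a k) (b k)) \<longlonglongrightarrow> 0"
      by (rule tendsto_sandwich[OF _ _ tendsto_const z]) (use ab in auto)
    then have "(\<lambda>k. norm (b k - a k)) \<longlonglongrightarrow> 0"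
      by (simp add: dist_norm norm_minus_commute)
    then have "(\<lambda>k. b k - a k) \<longlonglongrightarrow> 0"
      by (rule tendsto_norm_zero_cancel)
    then have b_lim: "b \<longlonglongrightarrow> p y"
      by (rule Lim_transform[OF a_lim])
    have d_lim: "(\<lambda>k. dist (a k) y) \<longlonglongrightarrow> dist (p y) y" "(\<lambda>k. dist (b k) y) \<longlonglongrightarrow> dist (p y) y"
      by (rule tendsto_dist[OF a_lim tendsto_const] tendsto_dist[OF b_lim tendsto_const])+
    have "dist (a k) y \<le> 1" "1 \<le> dist (b k) y" for k
      using G_inv[of k] by (auto simp: crosses_def a_def b_def)
    then have "dist (p y) y \<le> 1" "1 \<le> dist (p y) y"
      by (auto intro: LIMSEQ_le_const2[OF d_lim(1)] LIMSEQ_le_const[OF d_lim(2)])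
    then have "dist (p y) y = 1" by simp
    moreover have "p y + e \<in> limsup U" if e: "norm e = 1" "e \<bullet> dir (\<psi> y) \<noteq> 0" for e
    proof (rule ccontr)
      assume "p y + e \<notin> limsup U"
      then obtain n where n: "\<And>m. n \<le> m \<Longrightarrow> p y + e \<notin> U m"
        by (auto simp: limsup_INF_SUP)
      \<comment> \<open>The limit \<open>p y\<close> lies in every closed tube of the branch, so
        escaping \<open>U j\<close> bounds the inner product with the normal at level
        \<open>Suc j\<close>.\<close>
      have small: "\<bar>e \<bullet> dir (node_angle (G y k))\<bar> \<le> 2 * (1/2) ^ k" if "k > n" for k
      proof -
        obtain j where j: "k = Suc j" "n \<le> j" using \<open>k > n\<close> by (cases k) auto
        have "p y \<in> node_tube (G y k)"
          using closed_tube[of "a k" "b k" "\<delta> k"] a_lim a_tube[of k] unfolding tube_eq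
          by (intro Lim_in_closed_set[of _ a sequentially]) (auto simp: eventually_sequentially)
        then have "\<not> (1/2) ^ j \<le> \<bar>e \<bullet> dir (node_angle (G y k))\<bar>"
          using ch_U[OF conjunct1[OF G_inv[of j]] G_ch[of j], of "p y" e] e(1) n[OF j(2)] unfolding j(1) by blast
        then show ?thesis by (simp add: j)
      qed
      have "e \<bullet> dir (\<psi> y) = 0"
        unfolding \<psi>_def by (rule inner_dir_limsup_eq_0[OF ab(4,5) small z])
      then show False using e by simp
    qed
    ultimately show ?thesis by blast
  qed
  show ?thesis
    by (rule that[OF A_null p_borel \<psi>_borel]) (use main in blast)
qed

text \<open>Some translation from a countable dense set moves a given \<open>y\<close> into the ball
  already treated, and countably many translates of the null set are null. Taking the least suitable
  index keeps everything Borel.\<close>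

theorem nikodym_spheres:
  obtains A :: "'a set" and p :: "'a \<Rightarrow> 'a" and \<psi> :: "'a \<Rightarrow> real"
  where "A \<in> null_sets lebesgue" "p \<in> borel_measurable borel" "\<psi> \<in> borel_measurable borel"
    "\<forall>y. dist (p y) y = 1 \<and> (\<forall>e. norm e = 1 \<and> e \<bullet> dir (\<psi> y) \<noteq> 0 \<longrightarrow> p y + e \<in> A)"
proof -
  obtain A p \<psi> where A: "A \<in> null_sets lebesgue" and
    p[measurable]: "p \<in> borel_measurable borel" and \<psi>[measurable]: "\<psi> \<in> borel_measurable borel" and
    pA: "\<forall>y. dist (- (1/2) *\<^sub>R e1) y \<le> 1/4 \<longrightarrow>
       dist (p y) y = 1 \<and> (\<forall>e. norm e = 1 \<and> e \<bullet> dir (\<psi> y) \<noteq> 0 \<longrightarrow> p y + e \<in> A)"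
    by (rule nikodym_spheres_ball)
  obtain D :: "'a set" where D: "countable D" "\<And>X. open X \<Longrightarrow> X \<noteq> {} \<Longrightarrow> \<exists>d\<in>D. d \<in> X"
    using countable_dense_exists by blast
  define c where "c = from_nat_into D"
  have "D \<noteq> {}" using D(2)[of UNIV] by auto
  have ex: "\<exists>i. dist (- (1/2) *\<^sub>R e1) (y - c i) \<le> 1/4" for y
  proof -
    obtain d where d: "d \<in> D" "d \<in> ball (y + (1/2) *\<^sub>R e1) (1/4)"
      using D(2)[of "ball (y + (1/2) *\<^sub>R e1) (1/4)"] by auto
    obtain i where "d = c i"
      using from_nat_into_surj[OF D(1) d(1)] by (auto simp: c_def)
    moreover have "dist (- (1/2) *\<^sub>R e1) (y - d) = dist (y + (1/2) *\<^sub>R e1) d"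
      unfolding dist_norm by (subst norm_minus_commute) (simp add: algebra_simps)
    ultimately show ?thesis using d(2) by (auto intro!: exI[of _ i])
  qed
  define g where "g y = (LEAST i. dist (- (1/2) *\<^sub>R e1) (y - c i) \<le> 1/4)" for y
  have g: "dist (- (1/2) *\<^sub>R e1) (y - c (g y)) \<le> 1/4" for y
    unfolding g_def using ex[of y] by (rule LeastI_ex)
  have [measurable]: "g \<in> measurable borel (count_space UNIV)"
    unfolding g_def by measurable
  define P where "P y = c (g y) + p (y - c (g y))" for y
  define \<Psi> where "\<Psi> y = \<psi> (y - c (g y))" for y
  show ?thesis
  proof (rule that[of "\<Union>i. (+) (c i) ` A" P \<Psi>])
    show "(\<Union>i. (+) (c i) ` A) \<in> null_sets lebesgue"
      using A by (intro null_sets_UN) (auto simp: negligible_iff_null_sets[symmetric] negligible_translation)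
    show "P \<in> borel_measurable borel"
      unfolding P_def by (rule measurable_compose_countable[of "\<lambda>i y. c i + p (y - c i)"]) measurable
    show "\<Psi> \<in> borel_measurable borel"
      unfolding \<Psi>_def by (rule measurable_compose_countable[of "\<lambda>i y. \<psi> (y - c i)"]) measurable
    show "\<forall>y. dist (P y) y = 1 \<and> (\<forall>e. norm e = 1 \<and> e \<bullet> dir (\<Psi> y) \<noteq> 0 \<longrightarrow> P y + e \<in> (\<Union>i. (+) (c i) ` A))"
    proof (intro allI conjI impI)
      fix y
      have *: "dist (p (y - c (g y))) (y - c (g y)) = 1"
        "\<And>e. norm e = 1 \<Longrightarrow> e \<bullet> dir (\<Psi> y) \<noteq> 0 \<Longrightarrow> p (y - c (g y)) + e \<in> A"
        using pA g[of y] unfolding \<Psi>_def by blast+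
      show "dist (P y) y = 1"
        using *(1) by (simp add: P_def dist_norm algebra_simps)
      fix e assume "norm e = 1 \<and> e \<bullet> dir (\<Psi> y) \<noteq> 0"
      then have "P y + e \<in> (+) (c (g y)) ` A"
        using *(2)[of e] unfolding P_def by (auto simp: add.assoc)
      then show "P y + e \<in> (\<Union>i. (+) (c i) ` A)" by blast
    qed
  qed
qed

end

text \<open>By Cauchy-Schwarz no point of the hyperplane is nearer than
  \<open>\<bar>v \<bullet> x\<bar>\<close>. The formula makes the projection matrix explicit, for
  the measurability of the hyperplanes.\<close>

lemma closest_point_hyperplane:
  fixes v x :: "'a::euclidean_space"
  assumes "norm v = 1"
  shows "closest_point {x. v \<bullet> x = 0} x = x - (v \<bullet> x) *\<^sub>R v"
proof (rule closest_point_unique[symmetric])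
  have vv: "v \<bullet> v = 1" using assms by (simp add: norm_eq_1)
  show "convex {x. v \<bullet> x = 0}" by (rule convex_hyperplane)
  show "closed {x. v \<bullet> x = 0}" by (rule closed_hyperplane)
  show "x - (v \<bullet> x) *\<^sub>R v \<in> {x. v \<bullet> x = 0}"
    by (simp add: inner_diff vv)
  show "\<forall>z\<in>{x. v \<bullet> x = 0}. dist x (x - (v \<bullet> x) *\<^sub>R v) \<le> dist x z"
  proof
    fix z assume "z \<in> {x. v \<bullet> x = 0}"
    then have "\<bar>v \<bullet> x\<bar> = \<bar>v \<bullet> (x - z)\<bar>" by (simp add: inner_diff)
    also have "\<dots> \<le> norm v * norm (x - z)" by (rule Cauchy_Schwarz_ineq2)
    finally show "dist x (x - (v \<bullet> x) *\<^sub>R v) \<le> dist x z"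
      using assms by (simp add: dist_norm)
  qed
qed

theorem theorem1p1:
  assumes "CARD('n) \<ge> 2"
  shows "\<exists>(A :: (real^'n) set) (p :: real^'n \<Rightarrow> real^'n) (V :: real^'n \<Rightarrow> (real^'n) set).
           A \<in> null_sets lebesgue \<and>
           (\<forall>y. lin_hyperplane (V y) \<and> y \<in> sphere (p y) 1 \<and>
                (\<lambda>x. p y + x) ` (sphere 0 1 - V y) \<subseteq> A) \<and>
           p \<in> borel_measurable borel \<and>
           (\<lambda>y. proj_matrix (V y)) \<in> borel_measurable borel"
proof -
  \<comment> \<open>Dimension at least 2 enters here: two coordinate axes span the plane of
    directions.\<close>
  obtain i j :: 'n where ij: "i \<noteq> j"
    using assms card_le_Suc0_iff_eq[of "UNIV :: 'n set"] by fastforce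
  interpret orthonormal_pair "axis i 1 :: real^'n" "axis j 1"
    by unfold_locales (use ij in \<open>auto simp: inner_axis_axis\<close>)
  obtain A p \<psi> where A: "A \<in> null_sets lebesgue" and p: "p \<in> borel_measurable borel" and
    \<psi>: "\<psi> \<in> borel_measurable borel" and
    pA: "\<forall>y. dist (p y) y = 1 \<and> (\<forall>e. norm e = 1 \<and> e \<bullet> dir (\<psi> y) \<noteq> 0 \<longrightarrow> p y + e \<in> A)"
    by (rule nikodym_spheres)
  define V where "V y = {x. dir (\<psi> y) \<bullet> x = 0}" for y
  have hyper: "lin_hyperplane (V y)" for y
  proof -
    have "dir (\<psi> y) \<noteq> 0" using norm_dir[of "\<psi> y"] by fastforce
    then show ?thesis
      unfolding lin_hyperplane_def V_def by (simp add: dim_hyperplane subspace_hyperplane)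
  qed
  \<comment> \<open>This is the identity minus \<open>v\<close> times its transpose for the unit
    normal \<open>v = dir (\<psi> y)\<close>, a continuous function of the Borel angle.\<close>
  have "proj_matrix (V y) = (\<chi> k l. axis l 1 $ k - dir (\<psi> y) $ l * dir (\<psi> y) $ k)" for y
    unfolding proj_matrix_def V_def by (simp add: closest_point_hyperplane inner_axis)
  moreover have "continuous_on UNIV (\<lambda>\<theta>. \<chi> k l. axis l 1 $ k - dir \<theta> $ l * dir \<theta> $ k :: real^'n^'n)"
    unfolding dir_def by (intro continuous_intros)
  then have "(\<lambda>\<theta>. \<chi> k l. axis l 1 $ k - dir \<theta> $ l * dir \<theta> $ k :: real^'n^'n) \<in> borel_measurable borel"
    by (rule borel_measurable_continuous_onI)
  then have "(\<lambda>y. \<chi> k l. axis l 1 $ k - dir (\<psi> y) $ l * dir (\<psi> y) $ k :: real^'n^'n) \<in> borel_measurable borel"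
    by (rule measurable_compose[OF \<psi>])
  ultimately have "(\<lambda>y. proj_matrix (V y)) \<in> borel_measurable borel" by simp
  moreover have "(\<lambda>x. p y + x) ` (sphere 0 1 - V y) \<subseteq> A" for y
  proof clarify
    fix x assume "x \<in> sphere 0 1" "x \<notin> V y"
    then have "norm x = 1" "x \<bullet> dir (\<psi> y) \<noteq> 0" by (auto simp: V_def inner_commute)
    then show "p y + x \<in> A" using pA by blast
  qed
  ultimately show ?thesis
    using A p hyper pA by (intro exI[of _ A] exI[of _ p] exI[of _ V]) simp
qed

end
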